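(* Let $n\ge1$ be an integer, $0<m<1$, and let $V\in W^{2,\infty}_{loc}(\mathbb R^n)$ satisfy $V\ge0$, $V(0)=0$ and, for some $\varepsilon>0$, $$\inf_{\rho\in\mathcal P(\mathbb R^n)\cap L^1(\mathbb R^n)}\left(\frac1{m-1}\int_{\mathbb R^n}\rho^m\,dx+(1-\varepsilon)\int_{\mathbb R^n}V\rho\,dx\right)>-\infty .$$ Then: 1. There exists a constant $C>0$ such that for all $\rho\in\mathcal P(\mathbb R^n)\cap L^1(\mathbb R^n)$, $$\int_{\mathbb R^n}\rho^m\,dx+\int_{\mathbb R^n}V\rho\,dx\le C\left(1+\mathcal F[\rho]\right).$$ If, furthermore, $V$ is radially symmetric and non-decreasing in $|x|$, then: 2. There exists $\mu_\infty\in\mathcal P(\mathbb R^n)$ such that $$\widetilde{\mathcal F}[\mu_\infty]=\inf_{\mu\in\mathcal P(\mathbb R^n)}\widetilde{\mathcal F}[\mu]=\inf_{\rho\in\mathcal P(\mathbb R^n)\cap L^1(\mathbb R^n)}\mathcal F[\rho].$$ 3. One has $$\mu_\infty=\begin{cases}\rho_{V+h}&\text{if }a_{V+h}=1\text{ for some }h\ge0,\\(1-a_V)\delta_0+\rho_V&\text{if }a_V<1.\end{cases}$$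
   Context: $\mathcal P(\mathbb R^n)$ is the set of Borel probability measures; $L^1$ functions are identified with absolutely continuous measures. $\mathcal F[\rho]=\tfrac1{m-1}\int_{\mathbb R^n}\rho^m\,dx+\int_{\mathbb R^n}V\rho\,dx$ and $\widetilde{\mathcal F}[\mu]=\tfrac1{m-1}\int_{\mathbb R^n}\mu_{ac}^m\,dx+\int_{\mathbb R^n}V\,d\mu$, where $\mu_{ac}$ is the density of the absolutely continuous part of $\mu$; these (and the functional in the hypothesis) are taken to be $+\infty$ when the integral of $V$ is $+\infty$. For $h\ge0$, $\rho_{V+h}(x)=\left(\tfrac{1-m}{m}(V(x)+h)\right)^{-\frac1{1-m}}$ and $a_{V+h}=\int_{\mathbb R^n}\rho_{V+h}\,dx$.
   Formalization: Item 1 is false as stated (n=1, m=2/3, V=x², ρ=1 on [-1/2,1/2] gives F<-1); the formal bound is C(K+F[ρ]) with some K>0, and K=1 whenever inf F>-1, which is exactly when the stated bound can hold. *)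

theory Defs
  imports "HOL-Probability.Probability"
begin

section \<open>The Sobolev space \<open>W\<^sup>2\<^sup>,\<^sup>\<infinity>\<close>, local version\<close>

definition pd :: "'n \<Rightarrow> (real ^ 'n \<Rightarrow> real) \<Rightarrow> real ^ 'n \<Rightarrow> real" where
  "pd i f x = frechet_derivative f (at x) (axis i 1)"

fun Ck :: "nat \<Rightarrow> (real ^ 'n \<Rightarrow> real) \<Rightarrow> bool" where
  "Ck 0 f \<longleftrightarrow> continuous_on UNIV f"
| "Ck (Suc k) f \<longleftrightarrow> (\<forall>x. f differentiable at x) \<and> (\<forall>i. Ck k (pd i f))"

definition test_function :: "(real ^ 'n \<Rightarrow> real) \<Rightarrow> bool" where
  "test_function \<phi> \<longleftrightarrow> (\<forall>k. Ck k \<phi>) \<and> compact (closure {x. \<phi> x \<noteq> 0})"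

definition Linf_loc :: "(real ^ 'n \<Rightarrow> real) set" where
  "Linf_loc = {f \<in> borel_measurable lborel.
     \<forall>K. compact K \<longrightarrow> (\<exists>C. AE x in lborel. x \<in> K \<longrightarrow> \<bar>f x\<bar> \<le> C)}"

definition weak_pd :: "'n \<Rightarrow> (real ^ 'n \<Rightarrow> real) \<Rightarrow> (real ^ 'n \<Rightarrow> real) \<Rightarrow> bool" where
  "weak_pd i f g \<longleftrightarrow>
     (\<forall>\<phi>. test_function \<phi> \<longrightarrow>
        (LINT x|lborel. f x * pd i \<phi> x) = - (LINT x|lborel. g x * \<phi> x))"

text \<open>An element of the Sobolev space is a class of functions modulo null sets. Since point values
  of \<open>V\<close> matter below (\<open>V 0 = 0\<close>, integrals of \<open>V\<close> against singular measures), the definition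
  selects the continuous representative, which every class has.\<close>

definition W2inf_loc :: "(real ^ 'n \<Rightarrow> real) set" where
  "W2inf_loc = {f \<in> Linf_loc. continuous_on UNIV f \<and>
     (\<exists>g h. (\<forall>i. g i \<in> Linf_loc \<and> weak_pd i f (g i)) \<and>
            (\<forall>i j. h i j \<in> Linf_loc \<and> weak_pd j (g i) (h i j)))}"


section \<open>Measures, densities and the functionals\<close>

definition borel_probs :: "(real ^ 'n) measure set" where
  "borel_probs = {\<mu>. prob_space \<mu> \<and> sets \<mu> = sets borel}"

definition prob_densities :: "(real ^ 'n \<Rightarrow> real) set" where
  "prob_densities = {\<rho> \<in> borel_measurable borel.
     (\<forall>x. 0 \<le> \<rho> x) \<and> (\<integral>\<^sup>+x. ennreal (\<rho> x) \<partial>lborel) = 1}"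

definition lebesgue_decomposition ::
  "(real ^ 'n) measure \<Rightarrow> (real ^ 'n \<Rightarrow> real) \<Rightarrow> (real ^ 'n) measure \<Rightarrow> bool" where
  "lebesgue_decomposition \<mu> f \<nu> \<longleftrightarrow>
     f \<in> borel_measurable borel \<and> (\<forall>x. 0 \<le> f x) \<and>
     sets \<nu> = sets borel \<and> (\<exists>N \<in> null_sets lborel. emeasure \<nu> (- N) = 0) \<and>
     (\<forall>A \<in> sets borel. emeasure \<mu> A = emeasure (density lborel (\<lambda>x. ennreal (f x))) A + emeasure \<nu> A)"

text \<open>For a finite Borel measure the decomposition exists and the density is unique almost
  everywhere; the choice of version is immaterial for the integrals below.\<close>

definition ac_density :: "(real ^ 'n) measure \<Rightarrow> real ^ 'n \<Rightarrow> real" where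
  "ac_density \<mu> = (SOME f. \<exists>\<nu>. lebesgue_decomposition \<mu> f \<nu>)"

definition power_integral :: "real \<Rightarrow> (real ^ 'n \<Rightarrow> real) \<Rightarrow> ennreal" where
  "power_integral m \<rho> = (\<integral>\<^sup>+x. ennreal (\<rho> x powr m) \<partial>lborel)"

definition potential :: "(real ^ 'n \<Rightarrow> real) \<Rightarrow> (real ^ 'n \<Rightarrow> real) \<Rightarrow> ennreal" where
  "potential V \<rho> = (\<integral>\<^sup>+x. ennreal (V x * \<rho> x) \<partial>lborel)"

text \<open>\<open>I\<close> stands for the integral of the \<open>m\<close>-th power, \<open>J\<close> for the integral of \<open>V\<close>, with
  coefficient \<open>\<theta>\<close>. The undetermined form \<open>-\<infinity> + \<infinity>\<close> and, for \<open>\<theta> \<le> 0\<close>, the value at \<open>J = \<infinity>\<close>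
  are fixed by convention as \<open>+\<infinity>\<close>. Note that \<open>1 / (m - 1) < 0\<close>.\<close>

definition energy :: "real \<Rightarrow> real \<Rightarrow> ennreal \<Rightarrow> ennreal \<Rightarrow> ereal" where
  "energy m \<theta> I J =
     (if J = \<infinity> then \<infinity> else ereal (1 / (m - 1)) * enn2ereal I + ereal \<theta> * enn2ereal J)"

definition weighted_free_energy :: "real \<Rightarrow> real \<Rightarrow> (real ^ 'n \<Rightarrow> real) \<Rightarrow> (real ^ 'n \<Rightarrow> real) \<Rightarrow> ereal" where
  "weighted_free_energy \<theta> m V \<rho> = energy m \<theta> (power_integral m \<rho>) (potential V \<rho>)"

definition free_energy :: "real \<Rightarrow> (real ^ 'n \<Rightarrow> real) \<Rightarrow> (real ^ 'n \<Rightarrow> real) \<Rightarrow> ereal" where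
  "free_energy m V \<rho> = weighted_free_energy 1 m V \<rho>"

text \<open>On the coercivity bound "integral of the \<open>m\<close>-th power plus integral of \<open>V\<close> is at most
  \<open>C (1 + free_energy)\<close>": the left side is nonnegative, so the constant 1 is admissible only if
  \<open>free_energy \<ge> -1\<close> throughout. This can fail under the hypotheses (dimension one, \<open>m = 2/3\<close>,
  \<open>V x = x\<^sup>2\<close>, \<open>\<rho>\<close> the indicator of \<open>[-1/2, 1/2]\<close>: the free energy is \<open>-3 + 1/12\<close>). The theorem
  therefore has \<open>C (K + free_energy)\<close> with a constant \<open>K > 0\<close>, and \<open>K = 1\<close> whenever the infimum
  of the free energy exceeds \<open>-1\<close>.\<close>

definition free_energy_ext :: "real \<Rightarrow> (real ^ 'n \<Rightarrow> real) \<Rightarrow> (real ^ 'n) measure \<Rightarrow> ereal" where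
  "free_energy_ext m V \<mu> =
     energy m 1 (power_integral m (ac_density \<mu>)) (\<integral>\<^sup>+x. ennreal (V x) \<partial>\<mu>)"


section \<open>The profiles\<close>

text \<open>The negative power is \<open>+\<infinity>\<close> where \<open>V + h\<close> vanishes (in particular at the origin if \<open>h = 0\<close>),
  whereas \<open>0 powr a = 0\<close> in the library; hence the case distinction. If \<open>V\<close> vanishes on a set of
  positive measure, the mass for \<open>h = 0\<close> is thus infinite.\<close>

definition profile :: "real \<Rightarrow> (real ^ 'n \<Rightarrow> real) \<Rightarrow> real \<Rightarrow> real ^ 'n \<Rightarrow> ennreal" where
  "profile m V h x =
     (if V x + h = 0 then \<infinity>
      else ennreal (((1 - m) / m * (V x + h)) powr (- 1 / (1 - m))))"

definition profile_mass :: "real \<Rightarrow> (real ^ 'n \<Rightarrow> real) \<Rightarrow> real \<Rightarrow> ennreal" where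
  "profile_mass m V h = (\<integral>\<^sup>+x. profile m V h x \<partial>lborel)"

definition attains_infima :: "real \<Rightarrow> (real ^ 'n \<Rightarrow> real) \<Rightarrow> (real ^ 'n) measure \<Rightarrow> bool" where
  "attains_infima m V \<mu> \<longleftrightarrow> \<mu> \<in> borel_probs \<and>
     free_energy_ext m V \<mu> = (INF \<nu> \<in> borel_probs. free_energy_ext m V \<nu>) \<and>
     (INF \<nu> \<in> borel_probs. free_energy_ext m V \<nu>) = (INF \<rho> \<in> prob_densities. free_energy m V \<rho>)"

end

theory Submission
  imports Defs
begin

text \<open>Coercivity: the energy with weight \<open>1 - \<epsilon>\<close> is bounded below, so \<open>\<epsilon>\<close> times the potential energy is
  controlled by the free energy, and then so is the integral of the \<open>m\<close>-th power.

  Minimisers: with \<open>r\<close> the profile at level \<open>h\<close>, Bernoulli's inequality \<open>t\<^sup>m \<le> m t + 1 - m\<close>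
  at \<open>t = s / r\<close> reads \<open>s\<^sup>m / (1 - m) \<le> (V + h) s + r\<^sup>m\<close>, with equality only for \<open>s = r\<close>. Integrating
  it for a probability measure with density \<open>f\<close> and singular part \<open>\<nu>\<close>, the energy is at least
  \<open>- h - \<integral>r\<^sup>m\<close>, and the excess is the integrated gap plus \<open>\<integral>V d\<nu> + h \<nu>(\<real>\<^sup>n)\<close>. It vanishes for \<open>f = r\<close>,
  \<open>\<nu> = 0\<close> if \<open>r\<close> has mass 1, and for \<open>f = r\<close>, \<open>\<nu>\<close> a multiple of \<open>\<delta>\<^sub>0\<close> if \<open>h = 0\<close> and \<open>r\<close> has
  mass below 1. Radial monotonicity only serves to make the origin the sole zero of \<open>V\<close> in the latter
  case. Testing the hypothesis with truncated profiles shows that \<open>\<integral>r\<^sup>m\<close> is finite and that the mass is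
  finite for \<open>h > 0\<close>; the mass then decreases continuously to 0, so one of the two cases occurs.\<close>

section \<open>Bernoulli's inequality for the profiles\<close>

text \<open>For positive \<open>t\<close>, with \<open>w\<close> the weighted mean on the right,
  apply \<open>ln y \<le> y - 1\<close> at \<open>t / w\<close> and at \<open>1 / w\<close>: the
  weighted right sides cancel, and the bound at \<open>t / w\<close> is strict because
  \<open>t \<noteq> w\<close>.\<close>

lemma powr_less_weighted_mean:
  fixes t m :: real
  assumes m: "0 < m" "m < 1" and t: "0 \<le> t" "t \<noteq> 1"
  shows "t powr m < m * t + (1 - m)"
proof (cases "t = 0")
  case False
  with t have t: "t > 0" by simp
  define w where "w = m * t + (1 - m)"
  have w: "w > 0" using m t by (simp add: w_def add_pos_pos)
  have "t \<noteq> w"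
  proof
    assume "t = w"
    then have "(1 - m) * (t - 1) = 0" by (simp add: w_def algebra_simps)
    with m assms(4) show False by simp
  qed
  then have ne: "ln (t / w) \<noteq> t / w - 1"
    using ln_eq_minus_one[of "t / w"] t w by auto
  have 1: "m * ln (t / w) < m * (t / w - 1)"
    using ln_le_minus_one[of "t / w"] ne t w m by simp
  have 2: "(1 - m) * ln (1 / w) \<le> (1 - m) * (1 / w - 1)"
    using ln_le_minus_one[of "1 / w"] w m by simp
  have "m * (t / w - 1) + (1 - m) * (1 / w - 1) = (m * t + (1 - m)) / w - 1"
    using w by (simp add: field_simps)
  also have "\<dots> = 0" using w by (simp add: w_def)
  finally have "m * ln (t / w) + (1 - m) * ln (1 / w) < 0" using 1 2 by linarith
  then have "m * ln t < ln w" using t w by (simp add: ln_div algebra_simps)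
  then have "exp (m * ln t) < w" using w by (simp add: ln_less_cancel_iff[symmetric] del: ln_less_cancel_iff)
  then show ?thesis using t by (simp add: powr_def w_def)
qed (use m in auto)

text \<open>Real-valued version of the profile: it is 0 rather than \<open>\<infinity>\<close> where \<open>V + h\<close> vanishes, which keeps
  \<open>rprofile_powr\<close> true there.\<close>

definition rprofile :: "real \<Rightarrow> (real ^ 'n \<Rightarrow> real) \<Rightarrow> real \<Rightarrow> real ^ 'n \<Rightarrow> real" where
  "rprofile m V h x = ((1 - m) / m * (V x + h)) powr (- 1 / (1 - m))"

lemma rprofile_nonneg [simp]: "0 \<le> rprofile m V h x"
  by (simp add: rprofile_def)

lemma rprofile_le_profile: "ennreal (rprofile m V h x) \<le> profile m V h x"
  by (simp add: rprofile_def profile_def)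

lemma profile_eq_rprofile: "V x + h \<noteq> 0 \<Longrightarrow> profile m V h x = ennreal (rprofile m V h x)"
  by (simp add: rprofile_def profile_def)

text \<open>The Euler-Lagrange equation \<open>r powr (m - 1) = (1 - m) / m * (V + h)\<close>,
  multiplied by \<open>m * r\<close> so that it survives where \<open>V x + h = 0\<close>.\<close>

lemma rprofile_powr:
  assumes "0 < m" "m < 1" "0 \<le> V x + h"
  shows "m * rprofile m V h x powr m = (1 - m) * ((V x + h) * rprofile m V h x)"
proof (cases "V x + h = 0")
  case False
  define c where "c = (1 - m) / m * (V x + h)"
  have c: "c > 0" using assms False by (simp add: c_def)
  have r: "rprofile m V h x = c powr (- 1 / (1 - m))" by (simp add: rprofile_def c_def)
  \<comment> \<open>The exponents agree: \<open>- m / (1 - m) = 1 - 1 / (1 - m)\<close>.\<close>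
  have "rprofile m V h x powr m = c powr (1 + (- 1 / (1 - m)))"
    using assms by (simp add: r powr_powr field_simps)
  also have "\<dots> = c * rprofile m V h x"
    using c powr_add[of c 1 "- 1 / (1 - m)"] by (simp add: r)
  finally show ?thesis using assms by (simp add: c_def field_simps)
qed (simp add: rprofile_def)

lemma rprofile_pos: "0 < m \<Longrightarrow> m < 1 \<Longrightarrow> 0 < V x + h \<Longrightarrow> 0 < rprofile m V h x"
  by (simp add: rprofile_def)

text \<open>Bernoulli's inequality at \<open>s / r\<close>, multiplied by \<open>r powr m\<close>.
  By \<open>rprofile_powr\<close> the linear term \<open>(V x + h) * s\<close> becomes a multiple of
  \<open>(s / r) * r powr m\<close>.\<close>

lemma
  fixes V :: "real ^ 'n \<Rightarrow> real"
  assumes m: "0 < m" "m < 1" and W: "0 < V x + h" and s: "0 \<le> s"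
  shows powr_le_rprofile: "s powr m \<le> (1 - m) * ((V x + h) * s + rprofile m V h x powr m)"
    and powr_eq_rprofile_iff:
      "s powr m = (1 - m) * ((V x + h) * s + rprofile m V h x powr m) \<longleftrightarrow> s = rprofile m V h x"
proof -
  define r where "r = rprofile m V h x"
  have r: "r > 0" using rprofile_pos[of m V x h] m W by (simp add: r_def)
  have e: "m * r powr m = (1 - m) * ((V x + h) * r)"
    using rprofile_powr[of m V x h] m W by (simp add: r_def)
  have "(1 - m) * ((V x + h) * s) = ((1 - m) * ((V x + h) * r)) * (s / r)" using r by simp
  also have "\<dots> = m * (s / r) * r powr m" by (simp add: e[symmetric])
  finally have R: "(1 - m) * ((V x + h) * s + r powr m) = (m * (s / r) + (1 - m)) * r powr m"
    unfolding distrib_left[of "1 - m"] by (simp only: distrib_right)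
  have "s powr m = (s / r * r) powr m" using r by simp
  also have "\<dots> = (s / r) powr m * r powr m" using r s by (subst powr_mult) auto
  finally have L: "s powr m = (s / r) powr m * r powr m" .
  have *: "s powr m < (1 - m) * ((V x + h) * s + r powr m)" if "s \<noteq> r"
    unfolding L R using powr_less_weighted_mean[OF m, of "s / r"] s r that
    by (intro mult_strict_right_mono) auto
  have **: "s powr m = (1 - m) * ((V x + h) * s + r powr m)" if "s = r"
    unfolding L R using r that by simp
  show "s powr m \<le> (1 - m) * ((V x + h) * s + rprofile m V h x powr m)"
    using * ** unfolding r_def[symmetric] by (cases "s = r") auto
  show "s powr m = (1 - m) * ((V x + h) * s + rprofile m V h x powr m) \<longleftrightarrow> s = rprofile m V h x"
    using * ** unfolding r_def[symmetric] by (cases "s = r") auto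
qed

section \<open>The Lebesgue decomposition\<close>

text \<open>The absolutely continuous part does not charge \<open>N\<close> and the singular part
  charges nothing else, so both are restrictions of \<open>\<mu>\<close>. Integrals and uniqueness
  then reduce to indicators under \<open>\<mu>\<close>.\<close>

lemma lebesgue_decomposition_measure_eqs:
  fixes \<mu> :: "(real ^ 'n) measure"
  assumes "lebesgue_decomposition \<mu> f \<nu>" "sets \<mu> = sets borel"
  obtains N where "N \<in> null_sets lborel" "emeasure \<nu> (- N) = 0"
    "density lborel (\<lambda>x. ennreal (f x)) = density \<mu> (indicator (- N))"
    "\<nu> = density \<mu> (indicator N)"
proof -
  from assms obtain N where N: "N \<in> null_sets lborel" "emeasure \<nu> (- N) = 0"
    and f [measurable]: "f \<in> borel_measurable borel" and sn: "sets \<nu> = sets borel"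
    and eq: "\<And>A. A \<in> sets borel \<Longrightarrow>
      emeasure \<mu> A = emeasure (density lborel (\<lambda>x. ennreal (f x))) A + emeasure \<nu> A"
    by (auto simp: lebesgue_decomposition_def)
  have [measurable]: "N \<in> sets borel" using N by auto
  have ac: "emeasure (density lborel (\<lambda>x. ennreal (f x))) (A \<inter> N) = 0" if "A \<in> sets borel" for A
  proof -
    have "absolutely_continuous lborel (density lborel (\<lambda>x. ennreal (f x)))"
      by (intro absolutely_continuousI_density) simp
    then have "N \<in> null_sets (density lborel (\<lambda>x. ennreal (f x)))"
      using N(1) by (auto simp: absolutely_continuous_def)
    then show ?thesis using that by (metis Int_commute null_setsD1 null_set_Int1 sets_density sets_lborel)
  qed
  have sing: "emeasure \<nu> (A \<inter> - N) = 0" if "A \<in> sets borel" for A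
    using emeasure_mono[of "A \<inter> - N" "- N" \<nu>] N(2) sn by auto
  have split: "emeasure M A = emeasure M (A \<inter> N) + emeasure M (A \<inter> - N)"
    if "A \<in> sets borel" "sets M = sets borel" for A and M :: "(real ^ 'n) measure"
  proof -
    have "emeasure M ((A \<inter> N) \<union> (A \<inter> - N)) = emeasure M (A \<inter> N) + emeasure M (A \<inter> - N)"
      using that by (subst plus_emeasure) auto
    moreover have "(A \<inter> N) \<union> (A \<inter> - N) = A" by auto
    ultimately show ?thesis by simp
  qed
  show thesis
  proof (rule that[OF N])
    show "density lborel (\<lambda>x. ennreal (f x)) = density \<mu> (indicator (- N))"
    proof (rule measure_eqI)
      fix A assume "A \<in> sets (density lborel (\<lambda>x. ennreal (f x)))"
      then have A [measurable]: "A \<in> sets borel" by simp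
      have "emeasure (density \<mu> (indicator (- N))) A = emeasure \<mu> (A \<inter> - N)"
        using assms(2) by (subst emeasure_restricted) (auto simp: Int_commute)
      also have "\<dots> = emeasure (density lborel (\<lambda>x. ennreal (f x))) (A \<inter> - N)"
        by (subst eq) (auto simp: sing)
      also have "\<dots> = emeasure (density lborel (\<lambda>x. ennreal (f x))) A"
        using split[OF A, of "density lborel (\<lambda>x. ennreal (f x))"] ac[OF A] by simp
      finally show "emeasure (density lborel (\<lambda>x. ennreal (f x))) A
        = emeasure (density \<mu> (indicator (- N))) A" by simp
    qed (simp add: assms)
    show "\<nu> = density \<mu> (indicator N)"
    proof (rule measure_eqI)
      fix A assume "A \<in> sets \<nu>"
      then have A [measurable]: "A \<in> sets borel" by (simp add: sn)
      have "emeasure (density \<mu> (indicator N)) A = emeasure \<mu> (A \<inter> N)"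
        using assms(2) by (subst emeasure_restricted) (auto simp: Int_commute)
      also have "\<dots> = emeasure \<nu> (A \<inter> N)"
        by (subst eq) (auto simp: ac)
      also have "\<dots> = emeasure \<nu> A"
        using split[OF A sn] sing[OF A] by simp
      finally show "emeasure \<nu> A = emeasure (density \<mu> (indicator N)) A" by simp
    qed (simp add: assms sn)
  qed
qed

lemma nn_integral_lebesgue_decomposition:
  assumes D: "lebesgue_decomposition \<mu> f \<nu>" and s: "sets \<mu> = sets borel"
    and [measurable]: "g \<in> borel_measurable borel"
  shows "(\<integral>\<^sup>+x. g x \<partial>\<mu>) = (\<integral>\<^sup>+x. ennreal (f x) * g x \<partial>lborel) + (\<integral>\<^sup>+x. g x \<partial>\<nu>)"
proof -
  obtain N where N: "N \<in> null_sets lborel"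
    and 1: "density lborel (\<lambda>x. ennreal (f x)) = density \<mu> (indicator (- N))"
    and 2: "\<nu> = density \<mu> (indicator N)"
    using lebesgue_decomposition_measure_eqs[OF D s] by metis
  have [measurable]: "N \<in> sets borel" using N by auto
  have [measurable]: "f \<in> borel_measurable borel" using D by (auto simp: lebesgue_decomposition_def)
  have [measurable_cong]: "sets \<mu> = sets borel" by fact
  have "(\<integral>\<^sup>+x. ennreal (f x) * g x \<partial>lborel) = (\<integral>\<^sup>+x. g x \<partial>density lborel (\<lambda>x. ennreal (f x)))"
    by (subst nn_integral_density) auto
  also have "\<dots> = (\<integral>\<^sup>+x. indicator (- N) x * g x \<partial>\<mu>)"
    unfolding 1 by (subst nn_integral_density) auto
  finally have f: "(\<integral>\<^sup>+x. ennreal (f x) * g x \<partial>lborel) = (\<integral>\<^sup>+x. indicator (- N) x * g x \<partial>\<mu>)" .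
  have "(\<integral>\<^sup>+x. g x \<partial>\<nu>) = (\<integral>\<^sup>+x. indicator N x * g x \<partial>\<mu>)"
    unfolding 2 by (subst nn_integral_density) auto
  with f have "(\<integral>\<^sup>+x. ennreal (f x) * g x \<partial>lborel) + (\<integral>\<^sup>+x. g x \<partial>\<nu>)
     = (\<integral>\<^sup>+x. indicator (- N) x * g x \<partial>\<mu>) + (\<integral>\<^sup>+x. indicator N x * g x \<partial>\<mu>)"
    by simp
  also have "\<dots> = (\<integral>\<^sup>+x. indicator (- N) x * g x + indicator N x * g x \<partial>\<mu>)"
    by (subst nn_integral_add) auto
  also have "\<dots> = (\<integral>\<^sup>+x. g x \<partial>\<mu>)"
    by (intro nn_integral_cong) (auto split: split_indicator)
  finally show ?thesis by simp
qed

text \<open>Restricting each density to the complement of the other decomposition's null set changes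
  it only on a null set, and turns both into \<open>\<mu>\<close> restricted to the complement of
  \<open>N \<union> N'\<close>.\<close>

lemma lebesgue_decomposition_unique:
  assumes D: "lebesgue_decomposition \<mu> f \<nu>" "lebesgue_decomposition \<mu> f' \<nu>'"
    and s: "sets \<mu> = sets borel"
  shows "AE x in lborel. f x = f' x"
proof -
  obtain N where N: "N \<in> null_sets lborel"
    and 1: "density lborel (\<lambda>x. ennreal (f x)) = density \<mu> (indicator (- N))"
    using lebesgue_decomposition_measure_eqs[OF D(1) s] by metis
  obtain N' where N': "N' \<in> null_sets lborel"
    and 2: "density lborel (\<lambda>x. ennreal (f' x)) = density \<mu> (indicator (- N'))"
    using lebesgue_decomposition_measure_eqs[OF D(2) s] by metis
  have [measurable]: "N \<in> sets borel" "N' \<in> sets borel" using N N' by auto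
  have [measurable]: "f \<in> borel_measurable borel" "f' \<in> borel_measurable borel"
    and nn: "\<And>x. 0 \<le> f x" "\<And>x. 0 \<le> f' x"
    using D by (auto simp: lebesgue_decomposition_def)
  have [measurable_cong]: "sets \<mu> = sets borel" by fact
  have aeN: "AE x in lborel. x \<notin> N \<and> x \<notin> N'"
    using AE_not_in[OF N] AE_not_in[OF N'] by eventually_elim auto
  have "density lborel (\<lambda>x. ennreal (f x)) = density lborel (\<lambda>x. indicator (- N') x * ennreal (f x))"
    using aeN by (intro density_cong) (auto simp: eventually_mono)
  also have "\<dots> = density (density lborel (\<lambda>x. ennreal (f x))) (indicator (- N'))"
    by (subst density_density_eq) (auto simp: mult.commute)
  also have "\<dots> = density (density lborel (\<lambda>x. ennreal (f' x))) (indicator (- N))"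
    unfolding 1 2 by (simp add: density_density_eq mult.commute)
  also have "\<dots> = density lborel (\<lambda>x. indicator (- N) x * ennreal (f' x))"
    by (subst density_density_eq) (auto simp: mult.commute)
  also have "\<dots> = density lborel (\<lambda>x. ennreal (f' x))"
    using aeN by (intro density_cong) (auto simp: eventually_mono)
  finally have "AE x in lborel. ennreal (f x) = ennreal (f' x)"
    by (subst (asm) sigma_finite_measure.density_unique_iff[OF sigma_finite_lborel]) auto
  then show ?thesis by eventually_elim (use nn in auto)
qed

text \<open>Exhaustion: a countable union \<open>N\<close> of null sets attains the supremum of
  \<open>\<mu>\<close> over null sets. Off \<open>N\<close> the measure is absolutely continuous, so
  Radon-Nikodym applies; its restriction to \<open>N\<close> is the singular part.\<close>

lemma lebesgue_decomposition_exists: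
  fixes \<mu> :: "(real ^ 'n) measure"
  assumes "finite_measure \<mu>" and s: "sets \<mu> = sets borel"
  obtains f \<nu> where "lebesgue_decomposition \<mu> f \<nu>"
proof -
  interpret finite_measure \<mu> by fact
  have [measurable_cong]: "sets \<mu> = sets borel" by fact
  let ?S = "emeasure \<mu> ` null_sets lborel"
  have "?S \<noteq> {}" by auto
  then obtain e :: "nat \<Rightarrow> ennreal" where e: "range e \<subseteq> ?S" "Sup ?S = (SUP n. e n)"
    using ennreal_Sup_countable_SUP[of ?S] by metis
  then have "\<forall>n. \<exists>A\<in>null_sets lborel. e n = emeasure \<mu> A" by auto
  then obtain A where A: "\<And>n. A n \<in> null_sets lborel" "\<And>n. e n = emeasure \<mu> (A n)" by metis
  define N where "N = (\<Union>n. A n)"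
  have N: "N \<in> null_sets lborel" unfolding N_def using A(1) by auto
  have [measurable]: "N \<in> sets borel" using N by auto
  have "Sup ?S \<le> emeasure \<mu> N"
    unfolding e(2) using A N by (intro SUP_least) (auto simp: N_def s intro!: emeasure_mono)
  then have max: "emeasure \<mu> B \<le> emeasure \<mu> N" if "B \<in> null_sets lborel" for B
    using that by (metis SUP_upper dual_order.trans)
  have ac: "absolutely_continuous lborel (density \<mu> (indicator (- N)))"
    unfolding absolutely_continuous_def
  proof
    fix B :: "(real ^ 'n) set" assume B: "B \<in> null_sets lborel"
    then have [measurable]: "B \<in> sets borel" by auto
    \<comment> \<open>If a null set had mass outside \<open>N\<close>, its union with
      \<open>N\<close> would exceed the supremum. Cancelling the mass of \<open>N\<close> uses that
      it is finite.\<close>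
    have "emeasure \<mu> (B - N) + emeasure \<mu> N = emeasure \<mu> ((B - N) \<union> N)"
      by (subst plus_emeasure) (auto simp: s)
    also have "\<dots> \<le> emeasure \<mu> N" using B N by (intro max) auto
    finally have "emeasure \<mu> N + emeasure \<mu> (B - N) \<le> emeasure \<mu> N + 0" by (simp add: add.commute)
    then have "emeasure \<mu> (B - N) \<le> 0"
      by (subst (asm) ennreal_add_left_cancel_le) (use emeasure_finite[of N] in auto)
    moreover have "emeasure (density \<mu> (indicator (- N))) B = emeasure \<mu> (B - N)"
      by (subst emeasure_restricted) (auto simp: s Diff_eq Int_commute)
    ultimately show "B \<in> null_sets (density \<mu> (indicator (- N)))"
      by (auto simp: null_sets_def s)
  qed
  obtain g where g [measurable]: "g \<in> borel_measurable lborel"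
    and gd: "density lborel g = density \<mu> (indicator (- N))"
    using sigma_finite_measure.Radon_Nikodym[OF sigma_finite_lborel ac] by (auto simp: s)
  have "integral\<^sup>N lborel g = emeasure (density lborel g) UNIV"
    by (subst emeasure_density) auto
  also have "\<dots> = emeasure \<mu> (UNIV - N)"
    unfolding gd by (subst emeasure_restricted) (auto simp: s Diff_eq Int_commute)
  finally have "integral\<^sup>N lborel g \<noteq> \<infinity>" by simp
  then have fin: "AE x in lborel. g x \<noteq> \<infinity>" by (intro nn_integral_PInf_AE) auto
  \<comment> \<open>\<open>g\<close> is infinite only on a null set, so the default value 0 of
    \<open>enn2real\<close> there does not change the measure.\<close>
  define f where "f x = enn2real (g x)" for x
  have [measurable]: "g \<in> borel_measurable borel" using g by simp
  have [measurable]: "f \<in> borel_measurable borel" unfolding f_def by measurable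
  have fd: "density lborel (\<lambda>x. ennreal (f x)) = density \<mu> (indicator (- N))"
    unfolding gd[symmetric] f_def using fin
    by (intro density_cong) (auto simp: less_top elim!: eventually_mono)
  have "lebesgue_decomposition \<mu> f (density \<mu> (indicator N))"
    unfolding lebesgue_decomposition_def
  proof (intro conjI allI ballI bexI[OF _ N])
    show "emeasure (density \<mu> (indicator N)) (- N) = 0"
      by (subst emeasure_restricted) (auto simp: s)
    fix B :: "(real ^ 'n) set" assume [measurable]: "B \<in> sets borel"
    have "emeasure \<mu> ((B \<inter> - N) \<union> (B \<inter> N)) = emeasure \<mu> (B \<inter> - N) + emeasure \<mu> (B \<inter> N)"
      by (subst plus_emeasure) (auto simp: s)
    moreover have "(B \<inter> - N) \<union> (B \<inter> N) = B" by auto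
    ultimately show "emeasure \<mu> B = emeasure (density lborel (\<lambda>x. ennreal (f x))) B
        + emeasure (density \<mu> (indicator N)) B"
      unfolding fd by (simp add: emeasure_restricted s Int_commute)
  qed (auto simp: f_def s)
  then show thesis by (rule that)
qed

lemma lebesgue_decomposition_ac_density:
  assumes "\<mu> \<in> borel_probs"
  obtains \<nu> where "lebesgue_decomposition \<mu> (ac_density \<mu>) \<nu>"
proof -
  have "finite_measure \<mu>" "sets \<mu> = sets borel"
    using assms by (auto simp: borel_probs_def prob_space.finite_measure)
  then obtain f \<nu> where "lebesgue_decomposition \<mu> f \<nu>" by (rule lebesgue_decomposition_exists)
  then have "\<exists>f \<nu>. lebesgue_decomposition \<mu> f \<nu>" by blast
  then have "\<exists>\<nu>. lebesgue_decomposition \<mu> (ac_density \<mu>) \<nu>"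
    unfolding ac_density_def by (rule someI_ex)
  with that show thesis by blast
qed

section \<open>The energy identity\<close>

locale continuous_potential =
  fixes m :: real and V :: "real ^ 'n \<Rightarrow> real"
  assumes m: "0 < m" "m < 1"
    and V_cont: "continuous_on UNIV V"
    and V_nonneg: "0 \<le> V x"
    and V_zero: "V 0 = 0"
begin

lemma V_measurable [measurable]: "V \<in> borel_measurable borel"
  using V_cont by (rule borel_measurable_continuous_onI)

lemma rprofile_measurable [measurable]: "rprofile m V h \<in> borel_measurable borel"
  unfolding rprofile_def by measurable

lemma profile_measurable [measurable]: "profile m V h \<in> borel_measurable borel"
  unfolding profile_def by measurable

text \<open>The profile is infinite exactly where \<open>V + h\<close> vanishes, and a finite
  integral allows this only on a null set.\<close>

lemma AE_profile_finite:
  assumes "profile_mass m V h \<noteq> \<infinity>"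
  shows "AE x in lborel. V x + h \<noteq> 0"
proof -
  have "AE x in lborel. profile m V h x \<noteq> \<infinity>"
    using assms unfolding profile_mass_def by (intro nn_integral_PInf_AE) auto
  then show ?thesis by eventually_elim (auto simp: profile_def)
qed

lemma nn_integral_rprofile:
  assumes "AE x in lborel. V x + h \<noteq> 0"
  shows "(\<integral>\<^sup>+x. ennreal (rprofile m V h x) \<partial>lborel) = profile_mass m V h"
  unfolding profile_mass_def using assms
  by (intro nn_integral_cong_AE) (auto simp: profile_eq_rprofile elim!: eventually_mono)

section \<open>Potential energy of combinations and of concentrated densities\<close>

lemma potential_add:
  assumes [measurable]: "f \<in> borel_measurable borel" "g \<in> borel_measurable borel"
    and "\<And>x. 0 \<le> f x" "\<And>x. 0 \<le> g x"
  shows "potential V (\<lambda>x. f x + g x) = potential V f + potential V g"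
  unfolding potential_def
  by (subst nn_integral_add[symmetric])
    (auto simp: assms V_nonneg distrib_left ennreal_plus simp del: ennreal_plus[symmetric]
      intro!: nn_integral_cong)

lemma potential_cmult:
  assumes [measurable]: "f \<in> borel_measurable borel" and "0 \<le> c"
  shows "potential V (\<lambda>x. c * f x) = ennreal c * potential V f"
  unfolding potential_def
  by (subst nn_integral_cmult[symmetric])
    (auto simp: assms ennreal_mult'[symmetric] mult_ac intro!: nn_integral_cong)

text \<open>The uniform density on a small ball about the origin, where continuity and
  \<open>V 0 = 0\<close> keep \<open>V\<close> below \<open>\<eta>\<close>. It replaces a Dirac mass
  at the origin wherever a density is required.\<close>

lemma concentrated_density:
  assumes "0 < \<eta>"
  obtains u where "u \<in> prob_densities" "potential V u \<le> ennreal \<eta>"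
proof -
  have "isCont V 0" using V_cont by (simp add: continuous_on_eq_continuous_at)
  then obtain \<delta>0 where \<delta>0: "\<delta>0 > 0" "\<And>x. dist x 0 < \<delta>0 \<Longrightarrow> dist (V x) (V 0) < \<eta>"
    using assms unfolding continuous_at_eps_delta by metis
  define \<delta> where "\<delta> = \<delta>0 / 2"
  have \<delta>: "\<delta> > 0" using \<delta>0 by (simp add: \<delta>_def)
  have le: "V x \<le> \<eta>" if "x \<in> cball 0 \<delta>" for x
    using \<delta>0(2)[of x] that \<delta>0(1) V_zero by (auto simp: \<delta>_def dist_real_def)
  define c where "c = unit_ball_vol (real DIM(real ^ 'n)) * \<delta> ^ DIM(real ^ 'n)"
  have c: "c > 0" using \<delta> by (simp add: c_def)
  have ec: "emeasure lborel (cball (0 :: real ^ 'n) \<delta>) = ennreal c"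
    using \<delta> by (subst emeasure_cball) (auto simp: c_def)
  define u :: "real ^ 'n \<Rightarrow> real" where "u x = indicator (cball 0 \<delta>) x / c" for x
  have [measurable]: "cball (0 :: real ^ 'n) \<delta> \<in> sets borel" by simp
  have [measurable]: "u \<in> borel_measurable borel" unfolding u_def by measurable
  have nn: "0 \<le> u x" for x using c by (simp add: u_def)
  have "(\<integral>\<^sup>+x. ennreal (u x) \<partial>lborel)
    = (\<integral>\<^sup>+x. ennreal (1 / c) * indicator (cball 0 \<delta>) x \<partial>(lborel :: (real ^ 'n) measure))"
    by (intro nn_integral_cong) (auto simp: u_def split: split_indicator)
  also have "\<dots> = ennreal (1 / c) * ennreal c"
    by (subst nn_integral_cmult_indicator) (auto simp: ec)
  also have "\<dots> = 1" using c by (subst ennreal_mult[symmetric]) auto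
  finally have one: "(\<integral>\<^sup>+x. ennreal (u x) \<partial>lborel) = 1" .
  have "potential V u \<le> (\<integral>\<^sup>+x. ennreal \<eta> * ennreal (u x) \<partial>lborel)"
    unfolding potential_def
  proof (rule nn_integral_mono)
    fix x show "ennreal (V x * u x) \<le> ennreal \<eta> * ennreal (u x)"
      using le[of x] c V_nonneg[of x] assms nn[of x]
      by (subst ennreal_mult[symmetric]) (auto simp: u_def divide_right_mono split: split_indicator)
  qed
  also have "\<dots> = ennreal \<eta>" by (subst nn_integral_cmult) (auto simp: one)
  finally have "potential V u \<le> ennreal \<eta>" .
  with one nn that[of u] show thesis by (auto simp: prob_densities_def)
qed

text \<open>The pointwise gap in Bernoulli's inequality, after division by
  \<open>1 - m\<close>.\<close>

definition deficit :: "real \<Rightarrow> (real ^ 'n \<Rightarrow> real) \<Rightarrow> real ^ 'n \<Rightarrow> real" where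
  "deficit h f x = (V x + h) * f x + rprofile m V h x powr m - f x powr m / (1 - m)"

lemma deficit_measurable [measurable]:
  assumes [measurable]: "f \<in> borel_measurable borel"
  shows "deficit h f \<in> borel_measurable borel"
  unfolding deficit_def by measurable

lemma deficit_nonneg: "0 < V x + h \<Longrightarrow> 0 \<le> f x \<Longrightarrow> 0 \<le> deficit h f x"
  using powr_le_rprofile[OF m, of V x h "f x"] m by (simp add: deficit_def field_simps)

lemma deficit_eq_0_iff:
  "0 < V x + h \<Longrightarrow> 0 \<le> f x \<Longrightarrow> deficit h f x = 0 \<longleftrightarrow> f x = rprofile m V h x"
  using powr_eq_rprofile_iff[OF m, of V x h "f x"] m by (auto simp: deficit_def field_simps)

text \<open>Of a measure only the absolutely continuous part \<open>f\<close>, the mass \<open>n\<close> and the potential energy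
  \<open>k\<close> of the singular part enter. Every claim about minimisers is read off this identity, as its
  last summand is nonnegative.\<close>

lemma energy_identity:
  assumes h: "0 \<le> h" and pos: "AE x in lborel. V x + h \<noteq> 0"
    and fin: "power_integral m (rprofile m V h) \<noteq> \<infinity>"
    and f [measurable]: "f \<in> borel_measurable borel" and f0: "\<And>x. 0 \<le> f x"
    and mass: "(\<integral>\<^sup>+x. ennreal (f x) \<partial>lborel) + n = 1"
    and J: "potential V f + k \<noteq> \<infinity>"
  shows "energy m 1 (power_integral m f) (potential V f + k) =
    ereal (- h - enn2real (power_integral m (rprofile m V h)))
    + enn2ereal (k + (\<integral>\<^sup>+x. ennreal (deficit h f x) \<partial>lborel) + ennreal h * n)"
proof -
  let ?r = "rprofile m V h" and ?D = "\<integral>\<^sup>+x. ennreal (deficit h f x) \<partial>lborel"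
    and ?a = "\<integral>\<^sup>+x. ennreal (f x) \<partial>lborel"
  \<comment> \<open>With the gap added to the power term, all integrands are nonnegative almost
    everywhere, and the identity holds in \<open>ennreal\<close> before the left side is known to be
    finite.\<close>
  have "ennreal (1 / (1 - m)) * power_integral m f + ?D
    = (\<integral>\<^sup>+x. ennreal (1 / (1 - m)) * ennreal (f x powr m) + ennreal (deficit h f x) \<partial>lborel)"
    unfolding power_integral_def by (subst nn_integral_add) (auto simp: nn_integral_cmult)
  also have "\<dots> = (\<integral>\<^sup>+x. (ennreal (V x * f x) + ennreal h * ennreal (f x)) + ennreal (?r x powr m) \<partial>lborel)"
  proof (rule nn_integral_cong_AE, use pos in eventually_elim)
    fix x assume "V x + h \<noteq> 0"
    then have "0 < V x + h" using V_nonneg[of x] h by linarith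
    then have d: "0 \<le> deficit h f x" using f0 by (rule deficit_nonneg)
    have "ennreal (1 / (1 - m)) * ennreal (f x powr m) + ennreal (deficit h f x)
      = ennreal (1 / (1 - m) * f x powr m + deficit h f x)"
      using d m by (subst ennreal_plus) (auto simp: ennreal_mult[symmetric])
    also have "1 / (1 - m) * f x powr m + deficit h f x = V x * f x + h * f x + ?r x powr m"
      by (simp add: deficit_def algebra_simps)
    also have "ennreal \<dots> = (ennreal (V x * f x) + ennreal h * ennreal (f x)) + ennreal (?r x powr m)"
      using f0[of x] h V_nonneg[of x]
      by (simp add: ennreal_plus ennreal_mult del: ennreal_plus[symmetric])
    finally show "ennreal (1 / (1 - m)) * ennreal (f x powr m) + ennreal (deficit h f x)
      = (ennreal (V x * f x) + ennreal h * ennreal (f x)) + ennreal (?r x powr m)" .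
  qed
  also have "\<dots> = potential V f + ennreal h * ?a + power_integral m ?r"
    unfolding power_integral_def potential_def by (simp add: nn_integral_add nn_integral_cmult)
  finally have eq: "ennreal (1 / (1 - m)) * power_integral m f + ?D
    = potential V f + ennreal h * ?a + power_integral m ?r" .
  have "?a \<noteq> \<infinity>" "n \<noteq> \<infinity>" using mass by auto
  then obtain a n' where a: "?a = ennreal a" "0 \<le> a" and n: "n = ennreal n'" "0 \<le> n'"
    by (metis ennreal_cases infinity_ennreal_def)
  obtain j k' where j: "potential V f = ennreal j" "0 \<le> j" and k: "k = ennreal k'" "0 \<le> k'"
    using J by (metis ennreal_add_eq_top ennreal_cases infinity_ennreal_def)
  obtain i where i: "power_integral m ?r = ennreal i" "0 \<le> i"
    using fin by (metis ennreal_cases infinity_ennreal_def)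
  have an: "a + n' = 1" using mass a n
    by (metis ennreal_1 ennreal_inj ennreal_plus add_nonneg_nonneg zero_le_one)
  have R: "potential V f + ennreal h * ?a + power_integral m ?r = ennreal (j + h * a + i)"
    using a j i h by (simp add: ennreal_plus ennreal_mult del: ennreal_plus[symmetric])
  \<comment> \<open>The right side is finite, hence so are both summands on the left, and the
    identity descends to the reals.\<close>
  have "?D \<noteq> \<infinity>" using eq R by (metis ennreal_add_eq_top ennreal_neq_top infinity_ennreal_def)
  then obtain d where d: "?D = ennreal d" "0 \<le> d" by (metis ennreal_cases infinity_ennreal_def)
  have "ennreal (1 / (1 - m)) * power_integral m f \<noteq> \<infinity>"
    using eq R by (metis ennreal_add_eq_top ennreal_neq_top infinity_ennreal_def)
  then have "power_integral m f \<noteq> \<infinity>" using m by (auto simp: ennreal_mult_eq_top_iff)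
  then obtain p where p: "power_integral m f = ennreal p" "0 \<le> p"
    by (metis ennreal_cases infinity_ennreal_def)
  have "ennreal (1 / (1 - m) * p + d) = ennreal (1 / (1 - m)) * ennreal p + ennreal d"
    using p d m by (subst ennreal_plus) (auto simp: ennreal_mult[symmetric])
  also have "\<dots> = ennreal (j + h * a + i)"
    using eq unfolding R p(1) d(1) .
  finally have e: "1 / (1 - m) * p + d = j + h * a + i"
    using p d m a j i h by (subst (asm) ennreal_inj) auto
  \<comment> \<open>The mass constraint trades \<open>h * a\<close> for \<open>h - h * n'\<close>:
    this is where the constant \<open>- h\<close> and the charge \<open>h * n\<close> on the
    singular mass come from.\<close>
  have hn: "h * a + h * n' = h" using an by (metis distrib_left mult.right_neutral)
  have "1 / (m - 1) * p = - (1 / (1 - m) * p)" using m by (simp add: field_simps)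
  then have "1 / (m - 1) * p + (j + k') = - h - i + (k' + d + h * n')"
    using e hn by linarith
  then show ?thesis
    unfolding p(1) j(1) k(1) n(1) i(1) d(1) using p(2) j(2) k(2) n(2) i(2) d(2) h
    by (simp add: energy_def enn2ereal_ennreal flip: ennreal_plus ennreal_mult)
qed

text \<open>The coefficient \<open>1 / (m - 1)\<close> is negative, so a larger power integral
  lowers the energy; an infinite \<open>J'\<close> is covered by the convention in
  \<open>energy\<close>.\<close>

lemma energy_mono:
  assumes "I' \<le> I" "J \<le> J'"
  shows "energy m 1 I J \<le> energy m 1 I' J'"
proof (cases "J' = \<infinity>")
  case False
  with assms have "J \<noteq> \<infinity>" using neq_top_trans by auto
  moreover have "ereal (1 / (m - 1)) * enn2ereal I \<le> ereal (1 / (m - 1)) * enn2ereal I'"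
  proof -
    have "ereal (1 / (1 - m)) * enn2ereal I' \<le> ereal (1 / (1 - m)) * enn2ereal I"
      using m assms by (intro ereal_mult_left_mono) (auto simp: less_eq_ennreal.rep_eq)
    moreover have "ereal (1 / (m - 1)) = - ereal (1 / (1 - m))" using m by (simp add: field_simps)
    ultimately show ?thesis by (simp only: ereal_mult_minus_left ereal_minus_le_minus)
  qed
  ultimately show ?thesis using False assms
    by (auto simp: energy_def less_eq_ennreal.rep_eq intro!: add_mono)
qed (simp add: energy_def)

end

section \<open>Finiteness and the mass of the profiles\<close>

text \<open>Monotone convergence along balls exhausting the space. It reduces bounds for the
  profiles to truncations with finite integrals.\<close>

lemma nn_integral_le_cballs:
  fixes F :: "real ^ 'n \<Rightarrow> ennreal"
  assumes [measurable]: "F \<in> borel_measurable borel"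
    and le: "\<And>k :: nat. (\<integral>\<^sup>+x. F x * indicator (cball 0 (real k)) x \<partial>lborel) \<le> B"
  shows "(\<integral>\<^sup>+x. F x \<partial>lborel) \<le> B"
proof (rule LIMSEQ_le_const2)
  have [measurable]: "cball (0 :: real ^ 'n) (real k) \<in> sets borel" for k by simp
  show "(\<lambda>k. \<integral>\<^sup>+x. F x * indicator (cball 0 (real k)) x \<partial>lborel) \<longlonglongrightarrow> (\<integral>\<^sup>+x. F x \<partial>lborel)"
  proof (rule nn_integral_LIMSEQ)
    show "incseq (\<lambda>k x. F x * indicator (cball 0 (real k)) x)"
      by (auto simp: incseq_def le_fun_def split: split_indicator)
    fix x
    have "eventually (\<lambda>k. F x * indicator (cball 0 (real k)) x = F x) sequentially"
      using eventually_ge_at_top[of "nat \<lceil>norm x\<rceil>"]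
      by eventually_elim (auto split: split_indicator)
    then show "(\<lambda>k. F x * indicator (cball 0 (real k)) x) \<longlonglongrightarrow> F x"
      by (rule tendsto_eventually)
  qed simp
qed (use le in auto)

context continuous_potential
begin

text \<open>Since \<open>t powr m \<le> 1 + t\<close>, finite measure of \<open>A\<close> and finite
  mass make the power integral finite; \<open>rprofile_powr\<close>, with \<open>h\<close> dropped,
  then bounds the potential energy by it.\<close>

lemma rprofile_truncation:
  fixes A :: "(real ^ 'n) set"
  assumes h: "0 \<le> h" and [measurable]: "A \<in> sets borel" and A: "emeasure lborel A \<noteq> \<infinity>"
    and g_def: "\<And>x. g x = rprofile m V h x * indicator A x"
    and fin: "(\<integral>\<^sup>+x. ennreal (g x) \<partial>lborel) \<noteq> \<infinity>"
  obtains i j where "power_integral m g = ennreal i" "potential V g = ennreal j"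
    "0 \<le> i" "0 \<le> j" "(1 - m) * j \<le> m * i"
proof -
  have [measurable]: "g \<in> borel_measurable borel" unfolding g_def[abs_def] by measurable
  have nn: "0 \<le> g x" for x by (simp add: g_def)
  have "power_integral m g \<le> (\<integral>\<^sup>+x. indicator A x + ennreal (g x) \<partial>lborel)"
    unfolding power_integral_def
  proof (rule nn_integral_mono)
    fix x
    have "t powr m \<le> 1 + t" if "0 \<le> t" for t
    proof (cases "t \<le> 1")
      case True
      then have "t powr m \<le> 1" using m that by (intro powr_le1) auto
      with that show ?thesis by simp
    next
      case False
      then have "t powr m \<le> t powr 1" using m by (intro powr_mono) auto
      with False show ?thesis by simp
    qed
    from this[OF nn[of x]] show "ennreal (g x powr m) \<le> indicator A x + ennreal (g x)"
      by (cases "x \<in> A") (auto simp: g_def ennreal_leI simp flip: ennreal_plus ennreal_1)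
  qed
  also have "\<dots> = emeasure lborel A + (\<integral>\<^sup>+x. ennreal (g x) \<partial>lborel)"
    by (subst nn_integral_add) auto
  also have "\<dots> < \<infinity>" using A fin by (auto simp: less_top)
  finally obtain i where i: "power_integral m g = ennreal i" "0 \<le> i"
    by (metis ennreal_cases infinity_ennreal_def less_irrefl)
  have "ennreal (1 - m) * potential V g = (\<integral>\<^sup>+x. ennreal ((1 - m) * (V x * g x)) \<partial>lborel)"
    unfolding potential_def using m by (subst nn_integral_cmult[symmetric]) (auto simp: ennreal_mult')
  also have "\<dots> \<le> (\<integral>\<^sup>+x. ennreal (m * g x powr m) \<partial>lborel)"
  proof (intro nn_integral_mono ennreal_leI)
    fix x
    have "(1 - m) * (V x * rprofile m V h x) \<le> (1 - m) * ((V x + h) * rprofile m V h x)"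
      using m h by (intro mult_left_mono mult_right_mono) auto
    then show "(1 - m) * (V x * g x) \<le> m * g x powr m"
      using rprofile_powr[OF m, of V x h] V_nonneg[of x] h by (cases "x \<in> A") (auto simp: g_def)
  qed
  also have "\<dots> = ennreal m * ennreal i"
    unfolding i(1)[symmetric] power_integral_def
    using m by (subst nn_integral_cmult[symmetric]) (auto simp: ennreal_mult')
  finally have le: "ennreal (1 - m) * potential V g \<le> ennreal m * ennreal i" .
  then have "ennreal (1 - m) * potential V g \<noteq> \<infinity>"
    by (metis ennreal_mult_eq_top_iff ennreal_neq_top infinity_ennreal_def top.extremum_unique)
  then have "potential V g \<noteq> \<infinity>" using m by (auto simp: ennreal_mult_eq_top_iff)
  then obtain j where j: "potential V g = ennreal j" "0 \<le> j"
    by (metis ennreal_cases infinity_ennreal_def)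
  have "(1 - m) * j \<le> m * i"
    using le i j m by (simp add: ennreal_mult[symmetric])
  with i j that show thesis by blast
qed

end

locale confining_potential = continuous_potential m V for m and V :: "real ^ 'n \<Rightarrow> real" +
  fixes M :: real
  assumes M_nonneg: "0 \<le> M"
    and power_bound: "\<rho> \<in> prob_densities \<Longrightarrow> potential V \<rho> \<noteq> \<infinity> \<Longrightarrow>
      power_integral m \<rho> \<le> ennreal (1 - m) * (potential V \<rho> + ennreal M)"
begin

text \<open>The missing mass is put where \<open>V\<close> is small, at bounded cost.\<close>

lemma power_bound_subprob:
  assumes g [measurable]: "g \<in> borel_measurable borel" and nn: "\<And>x. 0 \<le> g x"
    and mass: "(\<integral>\<^sup>+x. ennreal (g x) \<partial>lborel) \<le> 1" and J: "potential V g \<noteq> \<infinity>"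
  shows "power_integral m g \<le> ennreal (1 - m) * (potential V g + ennreal (M + 1))"
proof -
  obtain u where u: "u \<in> prob_densities" "potential V u \<le> ennreal 1"
    by (rule concentrated_density[of 1]) auto
  then have [measurable]: "u \<in> borel_measurable borel" and u0: "\<And>x. 0 \<le> u x"
    and u1: "(\<integral>\<^sup>+x. ennreal (u x) \<partial>lborel) = 1" by (auto simp: prob_densities_def)
  have "(\<integral>\<^sup>+x. ennreal (g x) \<partial>lborel) \<noteq> \<infinity>" using mass by (auto simp: top_unique)
  then obtain a where a: "(\<integral>\<^sup>+x. ennreal (g x) \<partial>lborel) = ennreal a" "0 \<le> a"
    by (metis ennreal_cases infinity_ennreal_def)
  have a1: "a \<le> 1" using mass a by simp
  define \<rho> where "\<rho> x = g x + (1 - a) * u x" for x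
  have [measurable]: "\<rho> \<in> borel_measurable borel" unfolding \<rho>_def by measurable
  have "(\<integral>\<^sup>+x. ennreal (\<rho> x) \<partial>lborel)
    = (\<integral>\<^sup>+x. ennreal (g x) + ennreal (1 - a) * ennreal (u x) \<partial>lborel)"
    using a1 nn u0 by (intro nn_integral_cong) (simp add: \<rho>_def ennreal_plus ennreal_mult)
  also have "\<dots> = ennreal a + ennreal (1 - a)"
    by (simp add: nn_integral_add nn_integral_cmult a u1)
  also have "\<dots> = 1" using a a1 by (simp flip: ennreal_plus)
  finally have \<rho>: "\<rho> \<in> prob_densities"
    using nn u0 a1 by (auto simp: prob_densities_def \<rho>_def)
  have "potential V \<rho> = potential V g + ennreal (1 - a) * potential V u"
    using nn u0 a1 unfolding \<rho>_def by (subst potential_add) (auto simp: potential_cmult)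
  also have "\<dots> \<le> potential V g + 1 * 1"
    using u a a1 by (intro add_mono mult_mono order_refl) (auto simp: ennreal_le_1)
  finally have J\<rho>: "potential V \<rho> \<le> potential V g + 1" by simp
  then have "potential V \<rho> \<noteq> \<infinity>" using J by (auto simp: top_unique)
  have "power_integral m g \<le> power_integral m \<rho>"
    unfolding power_integral_def \<rho>_def using nn u0 a1 m
    by (intro nn_integral_mono ennreal_leI powr_mono2) auto
  also have "\<dots> \<le> ennreal (1 - m) * (potential V \<rho> + ennreal M)"
    by (rule power_bound) fact+
  also have "\<dots> \<le> ennreal (1 - m) * ((potential V g + 1) + ennreal M)"
    using J\<rho> by (intro mult_left_mono add_mono) auto
  also have "(potential V g + 1) + ennreal M = potential V g + ennreal (M + 1)"
    using M_nonneg by (simp add: ennreal_plus add_ac)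
  finally show ?thesis .
qed

text \<open>For a truncation, \<open>power_bound_subprob\<close> gives
  \<open>i \<le> (1 - m) * (j + M + 1)\<close>. As \<open>(1 - m) * j \<le> m * i\<close> and
  \<open>m < 1\<close>, the potential term is absorbed on the left, and the resulting bound does not
  depend on the radius.\<close>

lemma power_integral_rprofile_le:
  assumes h: "0 \<le> h" and mass: "profile_mass m V h \<le> 1"
  shows "power_integral m (rprofile m V h) \<le> ennreal (M + 1)"
  unfolding power_integral_def
proof (rule nn_integral_le_cballs)
  fix k :: nat
  define A where "A = cball (0 :: real ^ 'n) (real k)"
  have [measurable]: "A \<in> sets borel" by (simp add: A_def)
  define g where "g x = rprofile m V h x * indicator A x" for x
  have [measurable]: "g \<in> borel_measurable borel" unfolding g_def by measurable
  have "(\<integral>\<^sup>+x. ennreal (g x) \<partial>lborel) \<le> profile_mass m V h"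
    unfolding profile_mass_def
    using rprofile_le_profile by (intro nn_integral_mono) (auto simp: g_def split: split_indicator)
  also note mass
  finally have g1: "(\<integral>\<^sup>+x. ennreal (g x) \<partial>lborel) \<le> 1" .
  have Af: "emeasure lborel A \<noteq> \<infinity>"
    using emeasure_lborel_cball_finite[of "0 :: real ^ 'n" "real k"] by (simp add: A_def)
  have gfin: "(\<integral>\<^sup>+x. ennreal (g x) \<partial>lborel) \<noteq> \<infinity>" using g1 by (auto simp: top_unique)
  obtain i j where ij: "power_integral m g = ennreal i" "potential V g = ennreal j"
    "0 \<le> i" "0 \<le> j" "(1 - m) * j \<le> m * i"
    by (rule rprofile_truncation[OF h _ Af g_def gfin]) simp
  have "power_integral m g \<le> ennreal (1 - m) * (potential V g + ennreal (M + 1))"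
    by (rule power_bound_subprob) (use g1 ij in \<open>auto simp: g_def\<close>)
  then have "i \<le> (1 - m) * (j + (M + 1))"
    using ij m M_nonneg by (simp add: ennreal_mult[symmetric] flip: ennreal_plus)
  then have "(1 - m) * i \<le> (1 - m) * (M + 1)" using ij(5) by (simp add: algebra_simps)
  then have "i \<le> M + 1" using m by simp
  then have "power_integral m g \<le> ennreal (M + 1)" using ij by (simp add: ennreal_leI)
  also have "power_integral m g
    = (\<integral>\<^sup>+x. ennreal (rprofile m V h x powr m) * indicator (cball 0 (real k)) x \<partial>lborel)"
    unfolding power_integral_def using m
    by (intro nn_integral_cong) (auto simp: g_def A_def split: split_indicator)
  finally show "(\<integral>\<^sup>+x. ennreal (rprofile m V h x powr m) * indicator (cball 0 (real k)) x \<partial>lborel)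
    \<le> ennreal (M + 1)" .
qed measurable

section \<open>Dependence of the profile and its mass on the level\<close>

lemma rprofile_antimono:
  assumes "0 < V x + h" "h \<le> h'"
  shows "rprofile m V h' x \<le> rprofile m V h x"
  unfolding rprofile_def using assms m
  by (intro powr_mono2') (auto intro!: mult_left_mono divide_right_mono)

text \<open>Rescaling a truncated profile of mass \<open>a\<close> to a probability density multiplies its \<open>m\<close>-th power
  integral by \<open>a powr - m\<close> but its potential energy only by \<open>1 / a\<close>, so \<open>a\<close> cannot be large.\<close>

lemma profile_mass_finite:
  assumes h: "0 < h"
  shows "profile_mass m V h \<noteq> \<infinity>"
proof -
  have pos: "0 < V x + h" for x using V_nonneg[of x] h by linarith
  \<comment> \<open>A uniform upper bound for the profile: \<open>V \<ge> 0\<close> and the exponent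
    is negative.\<close>
  define L where "L = ((1 - m) / m * h) powr (- 1 / (1 - m))"
  have L: "L > 0" using h m by (simp add: L_def)
  have r_le: "rprofile m V h x \<le> L" for x
    unfolding rprofile_def L_def using h m V_nonneg[of x]
    by (intro powr_mono2') (auto intro!: mult_left_mono divide_right_mono)
  \<comment> \<open>For a truncation of mass \<open>a > 1\<close> the argument ends in
    \<open>a \<le> Q * a powr m\<close>, that is \<open>a powr (1 - m) \<le> Q\<close>; the maximum
    with 1 in \<open>B\<close> covers the remaining masses.\<close>
  define Q where "Q = L powr (1 - m) * M"
  define B where "B = max 1 (Q powr (1 / (1 - m)))"
  have "(\<integral>\<^sup>+x. ennreal (rprofile m V h x) \<partial>lborel) \<le> ennreal B"
  proof (rule nn_integral_le_cballs)
    fix k :: nat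
    define A where "A = cball (0 :: real ^ 'n) (real k)"
    have [measurable]: "A \<in> sets borel" by (simp add: A_def)
    define g where "g x = rprofile m V h x * indicator A x" for x
    have [measurable]: "g \<in> borel_measurable borel" unfolding g_def by measurable
    have nn: "0 \<le> g x" for x by (simp add: g_def)
    have Af: "emeasure lborel A \<noteq> \<infinity>"
      using emeasure_lborel_cball_finite[of "0 :: real ^ 'n" "real k"] by (simp add: A_def)
    have "(\<integral>\<^sup>+x. ennreal (g x) \<partial>lborel) \<le> (\<integral>\<^sup>+x. ennreal L * indicator A x \<partial>lborel)"
      using r_le by (intro nn_integral_mono) (auto simp: g_def ennreal_leI split: split_indicator)
    also have "\<dots> = ennreal L * emeasure lborel A" by (subst nn_integral_cmult_indicator) auto
    also have "\<dots> < \<infinity>" using Af by (auto simp: ennreal_mult_less_top less_top)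
    finally have gfin: "(\<integral>\<^sup>+x. ennreal (g x) \<partial>lborel) \<noteq> \<infinity>" by simp
    then obtain a where a: "(\<integral>\<^sup>+x. ennreal (g x) \<partial>lborel) = ennreal a" "0 \<le> a"
      by (metis ennreal_cases infinity_ennreal_def)
    have "a \<le> B"
    proof (cases "a \<le> 1")
      case False
      then have a1: "a > 1" by simp
      obtain i j where ij: "power_integral m g = ennreal i" "potential V g = ennreal j"
        "0 \<le> i" "0 \<le> j" "(1 - m) * j \<le> m * i"
        by (rule rprofile_truncation[OF less_imp_le[OF h] _ Af g_def gfin]) simp
      define \<rho> where "\<rho> x = 1 / a * g x" for x
      have \<rho>m [measurable]: "\<rho> \<in> borel_measurable borel" unfolding \<rho>_def by measurable
      have "(\<integral>\<^sup>+x. ennreal (\<rho> x) \<partial>lborel) = (\<integral>\<^sup>+x. ennreal (1 / a) * ennreal (g x) \<partial>lborel)"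
        using nn a1 by (intro nn_integral_cong) (simp add: \<rho>_def flip: ennreal_mult)
      also have "\<dots> = ennreal (1 / a) * ennreal a" by (subst nn_integral_cmult) (auto simp: a)
      also have "\<dots> = 1" using a1 by (simp flip: ennreal_mult)
      finally have \<rho>: "\<rho> \<in> prob_densities"
        using nn a1 \<rho>m by (auto simp: prob_densities_def \<rho>_def)
      have J: "potential V \<rho> = ennreal (1 / a * j)"
        unfolding \<rho>_def using a1 ij by (subst potential_cmult) (auto simp flip: ennreal_mult)
      have "power_integral m \<rho> = (\<integral>\<^sup>+x. ennreal (a powr - m) * ennreal (g x powr m) \<partial>lborel)"
        unfolding power_integral_def \<rho>_def using nn a1
        by (intro nn_integral_cong) (simp add: powr_divide powr_minus_divide flip: ennreal_mult)
      also have "\<dots> = ennreal (a powr - m) * power_integral m g"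
        unfolding power_integral_def by (subst nn_integral_cmult) auto
      finally have I: "power_integral m \<rho> = ennreal (a powr - m * i)"
        using ij by (simp flip: ennreal_mult)
      have "power_integral m \<rho> \<le> ennreal (1 - m) * (potential V \<rho> + ennreal M)"
        using \<rho> J by (intro power_bound) auto
      then have "a powr - m * i \<le> (1 - m) * (1 / a * j + M)"
        using m M_nonneg ij a1 unfolding I J by (simp add: ennreal_mult[symmetric] flip: ennreal_plus)
      also have "\<dots> = 1 / a * ((1 - m) * j) + (1 - m) * M"
        by (simp only: distrib_left mult.left_commute)
      also have "\<dots> \<le> 1 / a * (m * i) + (1 - m) * M"
        using a1 by (intro add_right_mono mult_left_mono ij(5)) auto
      \<comment> \<open>Here \<open>a > 1\<close> is used: the weaker scaling factor is raised to
        \<open>a powr - m\<close>, so that this term can be absorbed on the left.\<close>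
      also have "1 / a * (m * i) \<le> a powr - m * (m * i)"
      proof (rule mult_right_mono)
        have "a powr - 1 \<le> a powr - m" using a1 m by (intro powr_mono) auto
        then show "1 / a \<le> a powr - m" using a1 by (simp add: powr_minus divide_inverse)
      qed (use m ij in auto)
      finally have "(1 - m) * (a powr - m * i) \<le> (1 - m) * M" by (simp add: algebra_simps)
      then have "a powr - m * i \<le> M" using m by simp
      then have i_le: "i \<le> M * a powr m" using a1 by (simp add: powr_minus field_simps)
      have "ennreal a \<le> (\<integral>\<^sup>+x. ennreal (L powr (1 - m)) * ennreal (g x powr m) \<partial>lborel)"
        unfolding a(1)[symmetric]
      proof (rule nn_integral_mono)
        fix x
        \<comment> \<open>Boundedness by \<open>L\<close> lets the power integral control the
          mass.\<close>
        have "g x = g x powr (1 - m) * g x powr m"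
          using nn[of x] by (cases "g x = 0") (auto simp flip: powr_add)
        also have "\<dots> \<le> L powr (1 - m) * g x powr m"
          using r_le[of x] L m nn[of x]
          by (intro mult_right_mono powr_mono2) (auto simp: g_def split: split_indicator)
        finally show "ennreal (g x) \<le> ennreal (L powr (1 - m)) * ennreal (g x powr m)"
          by (simp add: ennreal_leI flip: ennreal_mult)
      qed
      also have "\<dots> = ennreal (L powr (1 - m)) * power_integral m g"
        unfolding power_integral_def by (subst nn_integral_cmult) auto
      also have "\<dots> = ennreal (L powr (1 - m) * i)" using ij by (simp flip: ennreal_mult)
      finally have "a \<le> L powr (1 - m) * i" using ij by simp
      also have "\<dots> \<le> L powr (1 - m) * (M * a powr m)" using i_le by (intro mult_left_mono) auto
      finally have "a \<le> Q * a powr m" by (simp add: Q_def)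
      moreover have "a = a powr (1 - m) * a powr m" using a1 by (simp flip: powr_add)
      ultimately have "a powr (1 - m) * a powr m \<le> Q * a powr m" by simp
      then have "a powr (1 - m) \<le> Q" using a1 by simp
      then have "(a powr (1 - m)) powr (1 / (1 - m)) \<le> Q powr (1 / (1 - m))"
        using m by (intro powr_mono2) auto
      moreover have "(a powr (1 - m)) powr (1 / (1 - m)) = a" using a1 m by (simp add: powr_powr)
      ultimately show ?thesis by (simp add: B_def)
    qed (simp add: B_def)
    then have "(\<integral>\<^sup>+x. ennreal (g x) \<partial>lborel) \<le> ennreal B" using a by (simp add: ennreal_leI)
    also have "(\<integral>\<^sup>+x. ennreal (g x) \<partial>lborel)
      = (\<integral>\<^sup>+x. ennreal (rprofile m V h x) * indicator (cball 0 (real k)) x \<partial>lborel)"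
      by (intro nn_integral_cong) (auto simp: g_def A_def split: split_indicator)
    finally show "(\<integral>\<^sup>+x. ennreal (rprofile m V h x) * indicator (cball 0 (real k)) x \<partial>lborel)
      \<le> ennreal B" .
  qed measurable
  then have "profile_mass m V h \<le> ennreal B"
    using pos by (subst nn_integral_rprofile[symmetric]) (auto simp: less_imp_neq[THEN not_sym])
  then show ?thesis by (auto simp: top_unique)
qed

text \<open>At positive levels the mass becomes a real integral, open to dominated convergence and
  the intermediate value theorem.\<close>

lemma integrable_rprofile:
  assumes h: "0 < h"
  shows "integrable lborel (rprofile m V h)"
    and "profile_mass m V h = ennreal (LINT x|lborel. rprofile m V h x)"
proof -
  have "V x + h \<noteq> 0" for x using V_nonneg[of x] h by linarith
  then have eq: "(\<integral>\<^sup>+x. ennreal (rprofile m V h x) \<partial>lborel) = profile_mass m V h"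
    by (intro nn_integral_rprofile) auto
  then show I: "integrable lborel (rprofile m V h)"
    using profile_mass_finite[OF h] by (intro integrableI_nonneg) (auto simp: less_top)
  show "profile_mass m V h = ennreal (LINT x|lborel. rprofile m V h x)"
    unfolding eq[symmetric] using I by (intro nn_integral_eq_integral) auto
qed

text \<open>The mass exceeds 1 at some small positive level by monotone convergence, is below 1 at a
  large level, and is continuous in between by dominated convergence.\<close>

lemma profile_mass_eq_1:
  assumes "1 < profile_mass m V 0"
  obtains h where "0 < h" "profile_mass m V h = 1"
proof -
  define G where "G h = (LINT x|lborel. rprofile m V h x)" for h
  define p where "p = 1 / (1 - m)"
  have p: "p > 0" using m by (simp add: p_def)
  define c where "c = (1 - m) / m"
  have c: "c > 0" using m by (simp add: c_def)
  have r: "rprofile m V h x = (c * (V x + h)) powr (- p)" for h x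
    by (simp add: rprofile_def c_def p_def)
  have pos: "0 < V x + h" if "0 < h" for x h using V_nonneg[of x] that by linarith
  \<comment> \<open>Profiles increase as the level decreases to 0; monotone convergence also covers
    an infinite mass in the limit.\<close>
  have "(\<lambda>n. profile_mass m V (1 / real (Suc n))) \<longlonglongrightarrow> profile_mass m V 0"
    unfolding profile_mass_def
  proof (rule nn_integral_LIMSEQ)
    show "incseq (\<lambda>n. profile m V (1 / real (Suc n)))"
    proof (intro incseq_SucI le_funI)
      fix n x
      have "0 < V x + 1 / real (Suc n)" "0 < V x + 1 / real (Suc (Suc n))" by (intro pos; simp)+
      then show "profile m V (1 / real (Suc n)) x \<le> profile m V (1 / real (Suc (Suc n))) x"
        using rprofile_antimono[of x "1 / real (Suc (Suc n))" "1 / real (Suc n)"]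
        by (simp add: profile_eq_rprofile less_imp_neq[THEN not_sym] ennreal_leI frac_le)
    qed
    fix x
    have eq: "profile m V (1 / real (Suc n)) x = ennreal ((c * (V x + 1 / real (Suc n))) powr (- p))" for n
      using pos[of "1 / real (Suc n)" x] by (subst profile_eq_rprofile) (auto simp: r)
    have lim: "(\<lambda>n. c * (V x + 1 / real (Suc n))) \<longlonglongrightarrow> c * (V x + 0)"
      by (intro tendsto_intros LIMSEQ_Suc[OF lim_const_over_n])
    show "(\<lambda>n. profile m V (1 / real (Suc n)) x) \<longlonglongrightarrow> profile m V 0 x"
    \<comment> \<open>Where \<open>V\<close> vanishes the terms blow up, in agreement with the value
      \<open>\<infinity>\<close> of \<open>profile\<close> at level 0; elsewhere the power is
      continuous.\<close>
    proof (cases "V x = 0")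
      case True
      have "((\<lambda>n. (c * (V x + 1 / real (Suc n))) powr p) \<longlongrightarrow> 0) sequentially"
        using tendsto_powr2[OF lim, of "\<lambda>_. p" p] True c p by (simp add: eventually_sequentially)
      then have "LIM n sequentially. inverse ((c * (V x + 1 / real (Suc n))) powr p) :> at_top"
        using True c by (intro filterlim_inverse_at_top) auto
      then have "LIM n sequentially. (c * (V x + 1 / real (Suc n))) powr (- p) :> at_top"
        by (simp add: powr_minus)
      then show ?thesis unfolding eq using True
        by (simp add: profile_def ennreal_tendsto_top_eq_at_top)
    next
      case False
      then have "(\<lambda>n. (c * (V x + 1 / real (Suc n))) powr (- p)) \<longlonglongrightarrow> (c * (V x + 0)) powr (- p)"
        using c by (intro tendsto_powr lim tendsto_const) auto
      then show ?thesis unfolding eq using False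
        by (subst profile_eq_rprofile) (auto simp: r intro!: tendsto_ennrealI)
    qed
  qed simp
  then have "eventually (\<lambda>n. 1 < profile_mass m V (1 / real (Suc n))) sequentially"
    using assms by (rule order_tendstoD)
  then obtain n where n: "1 < profile_mass m V (1 / real (Suc n))"
    by (auto simp: eventually_sequentially)
  define h1 where "h1 = 1 / real (Suc n)"
  \<comment> \<open>The bound by 1 ensures \<open>h1 \<le> real (Suc k)\<close> for whichever
    \<open>k\<close> is chosen below.\<close>
  have h1: "h1 > 0" "h1 \<le> 1" by (auto simp: h1_def)
  have "1 < ennreal (G h1)" using n integrable_rprofile(2)[OF h1(1)] by (simp add: h1_def G_def)
  then have G1: "G h1 > 1" by (metis ennreal_1 ennreal_less_iff zero_le_one)
  have "(\<lambda>k. G (real (Suc k))) \<longlonglongrightarrow> (LINT x|(lborel :: (real ^ 'n) measure). 0)"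
    unfolding G_def
  proof (rule integral_dominated_convergence[where w = "rprofile m V 1"])
    show "AE x in lborel. (\<lambda>k. rprofile m V (real (Suc k)) x) \<longlonglongrightarrow> 0"
    proof (rule AE_I2)
      fix x
      have "LIM k sequentially. real k :> at_top" by (rule filterlim_real_sequentially)
      then have "LIM k sequentially. V x + (1 + real k) :> at_top"
        by (intro filterlim_tendsto_add_at_top[OF tendsto_const])
      then have "LIM k sequentially. c * (V x + real (Suc k)) :> at_top"
        using c by (intro filterlim_tendsto_pos_mult_at_top[OF tendsto_const]) (auto simp: add_ac)
      then show "(\<lambda>k. rprofile m V (real (Suc k)) x) \<longlonglongrightarrow> 0"
        unfolding r using p by (intro tendsto_neg_powr) auto
    qed
    show "AE x in lborel. norm (rprofile m V (real (Suc k)) x) \<le> rprofile m V 1 x" for k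
      using pos by (intro AE_I2) (auto intro!: rprofile_antimono)
  qed (auto intro: integrable_rprofile)
  then have "eventually (\<lambda>k. G (real (Suc k)) < 1) sequentially"
    by (rule order_tendstoD) simp
  then obtain k where k: "G (real (Suc k)) < 1" by (auto simp: eventually_sequentially)
  \<comment> \<open>The profile at the left endpoint \<open>h1 > 0\<close> dominates all profiles on
    the interval.\<close>
  have "continuous_on {h1..real (Suc k)} G"
  proof (rule continuous_on_sequentiallyI)
    fix u a assume u: "\<forall>n. u n \<in> {h1..real (Suc k)}" "a \<in> {h1..real (Suc k)}" "u \<longlonglongrightarrow> a"
    show "(\<lambda>n. G (u n)) \<longlonglongrightarrow> G a"
      unfolding G_def
    proof (rule integral_dominated_convergence[where w = "rprofile m V h1"])
      show "AE x in lborel. (\<lambda>n. rprofile m V (u n) x) \<longlonglongrightarrow> rprofile m V a x"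
      proof (rule AE_I2)
        fix x
        have "0 < V x + a" using u h1 by (intro pos) auto
        then show "(\<lambda>n. rprofile m V (u n) x) \<longlonglongrightarrow> rprofile m V a x"
          unfolding r using c by (intro tendsto_intros u) auto
      qed
      show "AE x in lborel. norm (rprofile m V (u n) x) \<le> rprofile m V h1 x" for n
        using pos u h1 by (intro AE_I2) (auto intro!: rprofile_antimono)
    qed (auto intro: integrable_rprofile h1)
  qed
  then have "\<exists>h\<ge>h1. h \<le> real (Suc k) \<and> G h = 1"
    using G1 k h1 by (intro IVT2') auto
  then obtain h where h: "h \<ge> h1" "G h = 1" by auto
  show thesis
    using h h1 integrable_rprofile(2)[of h] by (intro that[of h]) (auto simp: G_def)
qed

end

section \<open>Minimisers\<close>

text \<open>Used to assemble the minimiser from a density and a multiple of a Dirac mass.\<close>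

lemma emeasure_add_exists:
  fixes \<mu> \<nu> :: "(real ^ 'n) measure"
  assumes s: "sets \<mu> = sets borel" "sets \<nu> = sets borel"
  obtains \<kappa> where "sets \<kappa> = sets borel"
    "\<And>A. A \<in> sets borel \<Longrightarrow> emeasure \<kappa> A = emeasure \<mu> A + emeasure \<nu> A"
proof
  let ?\<kappa> = "measure_of UNIV (sets borel) (\<lambda>A. emeasure \<mu> A + emeasure \<nu> A)"
  have sa: "sigma_algebra UNIV (sets (borel :: (real ^ 'n) measure))"
    by (metis sets.sigma_algebra_axioms space_borel)
  show "sets ?\<kappa> = sets borel" by (simp add: sigma_algebra.sigma_sets_eq[OF sa])
  fix A :: "(real ^ 'n) set" assume "A \<in> sets borel"
  then show "emeasure ?\<kappa> A = emeasure \<mu> A + emeasure \<nu> A"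
  proof (intro emeasure_measure_of_sigma[OF sa])
    show "countably_additive (sets borel) (\<lambda>A. emeasure \<mu> A + emeasure \<nu> A)"
      unfolding countably_additive_def
      using s by (auto simp: suminf_add[symmetric] suminf_emeasure)
  qed (auto simp: positive_def)
qed

context continuous_potential
begin

text \<open>\<open>ac_density\<close> is an arbitrary choice of density; almost everywhere
  uniqueness lets any decomposition compute the energy.\<close>

lemma free_energy_ext_eq:
  assumes \<mu>: "\<mu> \<in> borel_probs" and D: "lebesgue_decomposition \<mu> f \<nu>"
  shows "free_energy_ext m V \<mu>
      = energy m 1 (power_integral m f) (potential V f + (\<integral>\<^sup>+x. ennreal (V x) \<partial>\<nu>))"
    and "(\<integral>\<^sup>+x. ennreal (f x) \<partial>lborel) + emeasure \<nu> UNIV = 1"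
proof -
  have s: "sets \<mu> = sets borel" and "prob_space \<mu>" using \<mu> by (auto simp: borel_probs_def)
  have [measurable]: "f \<in> borel_measurable borel" and f0: "\<And>x. 0 \<le> f x"
    using D by (auto simp: lebesgue_decomposition_def)
  obtain \<nu>' where "lebesgue_decomposition \<mu> (ac_density \<mu>) \<nu>'"
    using lebesgue_decomposition_ac_density[OF \<mu>] .
  then have "AE x in lborel. ac_density \<mu> x = f x"
    using lebesgue_decomposition_unique[OF _ D s] by blast
  then have I: "power_integral m (ac_density \<mu>) = power_integral m f"
    unfolding power_integral_def by (intro nn_integral_cong_AE) (auto elim!: eventually_mono)
  have "(\<integral>\<^sup>+x. ennreal (V x) \<partial>\<mu>)
      = (\<integral>\<^sup>+x. ennreal (f x) * ennreal (V x) \<partial>lborel) + (\<integral>\<^sup>+x. ennreal (V x) \<partial>\<nu>)"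
    by (rule nn_integral_lebesgue_decomposition[OF D s]) simp
  also have "(\<integral>\<^sup>+x. ennreal (f x) * ennreal (V x) \<partial>lborel) = potential V f"
    unfolding potential_def using f0 V_nonneg
    by (intro nn_integral_cong) (simp add: mult.commute flip: ennreal_mult)
  finally show "free_energy_ext m V \<mu>
      = energy m 1 (power_integral m f) (potential V f + (\<integral>\<^sup>+x. ennreal (V x) \<partial>\<nu>))"
    by (simp add: free_energy_ext_def I)
  have "emeasure \<mu> UNIV = 1"
    using prob_space.emeasure_space_1[OF \<open>prob_space \<mu>\<close>] s by (metis sets_eq_imp_space_eq space_borel)
  moreover have "emeasure \<mu> UNIV = emeasure (density lborel (\<lambda>x. ennreal (f x))) UNIV + emeasure \<nu> UNIV"
    using D by (auto simp: lebesgue_decomposition_def)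
  moreover have "emeasure (density lborel (\<lambda>x. ennreal (f x))) UNIV = (\<integral>\<^sup>+x. ennreal (f x) \<partial>lborel)"
    by (subst emeasure_density) auto
  ultimately show "(\<integral>\<^sup>+x. ennreal (f x) \<partial>lborel) + emeasure \<nu> UNIV = 1" by simp
qed

text \<open>\<open>rprofile_powr\<close> dominates \<open>V * r\<close> by a multiple of
  \<open>r powr m\<close>.\<close>

lemma potential_rprofile_finite:
  assumes h: "0 \<le> h" and fin: "power_integral m (rprofile m V h) \<noteq> \<infinity>"
  shows "potential V (rprofile m V h) \<noteq> \<infinity>"
proof -
  have "ennreal (1 - m) * potential V (rprofile m V h)
    = (\<integral>\<^sup>+x. ennreal ((1 - m) * (V x * rprofile m V h x)) \<partial>lborel)"
    unfolding potential_def using m by (subst nn_integral_cmult[symmetric]) (auto simp: ennreal_mult')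
  also have "\<dots> \<le> (\<integral>\<^sup>+x. ennreal m * ennreal (rprofile m V h x powr m) \<partial>lborel)"
  proof (intro nn_integral_mono)
    fix x
    have "(1 - m) * (V x * rprofile m V h x) \<le> (1 - m) * ((V x + h) * rprofile m V h x)"
      using m h by (intro mult_left_mono mult_right_mono) auto
    also have "\<dots> = m * rprofile m V h x powr m"
      using V_nonneg[of x] h by (intro rprofile_powr[symmetric] m) auto
    finally show "ennreal ((1 - m) * (V x * rprofile m V h x))
        \<le> ennreal m * ennreal (rprofile m V h x powr m)"
      using m by (simp add: ennreal_leI flip: ennreal_mult)
  qed
  also have "\<dots> = ennreal m * power_integral m (rprofile m V h)"
    unfolding power_integral_def by (subst nn_integral_cmult) auto
  also have "\<dots> < \<infinity>" using fin by (auto simp: ennreal_mult_less_top less_top)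
  finally have "ennreal (1 - m) * potential V (rprofile m V h) \<noteq> \<infinity>" by simp
  then show ?thesis using m by (auto simp: ennreal_mult_eq_top_iff)
qed

end

text \<open>Treats both cases of the result at once: mass 1 at some level \<open>h\<close>, or
  \<open>h = 0\<close> with mass below 1 and the origin as sole zero of \<open>V\<close>.\<close>

locale equilibrium = continuous_potential m V for m and V :: "real ^ 'n \<Rightarrow> real" +
  fixes h :: real
  assumes h: "0 \<le> h"
    and mass_le: "profile_mass m V h \<le> 1"
    and h_zero: "profile_mass m V h < 1 \<Longrightarrow> h = 0"
    and V_pos: "profile_mass m V h < 1 \<Longrightarrow> x \<noteq> 0 \<Longrightarrow> V x \<noteq> 0"
    and power_finite: "power_integral m (rprofile m V h) \<noteq> \<infinity>"
begin

abbreviation "r \<equiv> rprofile m V h"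
abbreviation "a \<equiv> profile_mass m V h"

definition min_energy :: real where
  "min_energy = - h - enn2real (power_integral m r)"

lemma AE_pos: "AE x in lborel. 0 < V x + h"
proof -
  have "AE x in lborel. V x + h \<noteq> 0" using mass_le by (intro AE_profile_finite) (auto simp: top_unique)
  then show ?thesis
    by eventually_elim (metis V_nonneg h add_nonneg_nonneg order_le_neq_trans)
qed

lemma AE_ne: "AE x in lborel. V x + h \<noteq> 0"
  using AE_pos by eventually_elim auto

lemma mass_r: "(\<integral>\<^sup>+x. ennreal (r x) \<partial>lborel) = a"
  using AE_ne by (rule nn_integral_rprofile)

lemma a_add: "a + (1 - a) = 1"
  using diff_add_cancel_ennreal[OF mass_le] by (simp add: add.commute)

text \<open>Complementary slackness: the multiplier \<open>h\<close> vanishes whenever the profile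
  leaves mass over.\<close>

lemma h_deficit: "ennreal h * (1 - a) = 0"
  using h_zero mass_le by (cases "a < 1") auto

lemma energy_eq:
  assumes "f \<in> borel_measurable borel" "\<And>x. 0 \<le> f x"
    and "(\<integral>\<^sup>+x. ennreal (f x) \<partial>lborel) + n = 1" "potential V f + k \<noteq> \<infinity>"
  shows "energy m 1 (power_integral m f) (potential V f + k) =
    ereal min_energy + enn2ereal (k + (\<integral>\<^sup>+x. ennreal (deficit h f x) \<partial>lborel) + ennreal h * n)"
  unfolding min_energy_def using assms by (intro energy_identity h AE_ne power_finite)

lemma energy_ge:
  assumes "f \<in> borel_measurable borel" "\<And>x. 0 \<le> f x"
    and "(\<integral>\<^sup>+x. ennreal (f x) \<partial>lborel) + n = 1"
  shows "ereal min_energy \<le> energy m 1 (power_integral m f) (potential V f + k)"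
proof (cases "potential V f + k = \<infinity>")
  case False
  then show ?thesis
    using assms by (subst energy_eq) (auto intro!: add_increasing2)
qed (simp add: energy_def)

text \<open>The profile has zero deficit and the missing mass costs nothing through
  \<open>h\<close>, so only \<open>k\<close> remains. The value \<open>k = 0\<close> serves the
  minimiser, \<open>k = \<eta>\<close> the approximating densities.\<close>

lemma energy_r:
  assumes "k \<noteq> \<infinity>"
  shows "energy m 1 (power_integral m r) (potential V r + k) = ereal min_energy + enn2ereal k"
proof -
  have "(\<integral>\<^sup>+x. ennreal (deficit h r x) \<partial>lborel) = (\<integral>\<^sup>+x. 0 \<partial>(lborel :: (real ^ 'n) measure))"
    by (intro nn_integral_cong_AE, use AE_pos in eventually_elim)
      (use deficit_eq_0_iff[of _ h r] in simp)
  then show ?thesis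
    using energy_eq[of r "1 - a" k] assms potential_rprofile_finite[OF h power_finite]
    by (simp add: mass_r a_add h_deficit)
qed

section \<open>Equality of the two infima\<close>

lemma free_energy_ge:
  assumes "\<rho> \<in> prob_densities"
  shows "ereal min_energy \<le> free_energy m V \<rho>"
  using energy_ge[of \<rho> 0 0] assms
  by (simp add: free_energy_def weighted_free_energy_def prob_densities_def)

text \<open>The missing mass is spread near the origin at potential cost at most
  \<open>\<eta>\<close>; the added density only increases the power integral, which lowers the
  energy.\<close>

lemma free_energy_le:
  assumes \<eta>: "0 < \<eta>"
  shows "\<exists>\<rho>\<in>prob_densities. free_energy m V \<rho> \<le> ereal min_energy + ereal \<eta>"
proof -
  obtain u where u: "u \<in> prob_densities" "potential V u \<le> ennreal \<eta>"
    using concentrated_density[OF \<eta>] .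
  then have [measurable]: "u \<in> borel_measurable borel" and u0: "\<And>x. 0 \<le> u x"
    and u1: "(\<integral>\<^sup>+x. ennreal (u x) \<partial>lborel) = 1" by (auto simp: prob_densities_def)
  define b where "b = enn2real (1 - a)"
  have b: "0 \<le> b" "ennreal b = 1 - a" "b \<le> 1"
    using enn2real_mono[of "1 - a" 1] by (auto simp: b_def less_top[symmetric] diff_le_self_ennreal)
  define \<rho> where "\<rho> x = r x + b * u x" for x
  have \<rho>m [measurable]: "\<rho> \<in> borel_measurable borel" unfolding \<rho>_def by measurable
  have "(\<integral>\<^sup>+x. ennreal (\<rho> x) \<partial>lborel) = (\<integral>\<^sup>+x. ennreal (r x) + ennreal b * ennreal (u x) \<partial>lborel)"
    using b u0 by (intro nn_integral_cong) (simp add: \<rho>_def ennreal_mult)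
  also have "\<dots> = 1"
    by (simp add: nn_integral_add nn_integral_cmult mass_r u1 b a_add)
  finally have \<rho>: "\<rho> \<in> prob_densities"
    using u0 b \<rho>m by (auto simp: prob_densities_def \<rho>_def)
  have "potential V \<rho> = potential V r + ennreal b * potential V u"
    using u0 b unfolding \<rho>_def by (subst potential_add) (auto simp: potential_cmult)
  also have "\<dots> \<le> potential V r + 1 * ennreal \<eta>"
    using u b by (intro add_mono mult_mono order_refl) (auto simp: diff_le_self_ennreal)
  finally have "potential V \<rho> \<le> potential V r + ennreal \<eta>" by simp
  moreover have "power_integral m r \<le> power_integral m \<rho>"
    unfolding power_integral_def \<rho>_def using u0 b m
    by (intro nn_integral_mono ennreal_leI powr_mono2) auto
  ultimately have "free_energy m V \<rho> \<le> energy m 1 (power_integral m r) (potential V r + ennreal \<eta>)"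
    unfolding free_energy_def weighted_free_energy_def by (intro energy_mono)
  also have "\<dots> = ereal min_energy + ereal \<eta>"
    using \<eta> by (subst energy_r) (auto simp: enn2ereal_ennreal)
  finally show ?thesis using \<rho> by blast
qed

lemma INF_free_energy: "(INF \<rho>\<in>prob_densities. free_energy m V \<rho>) = ereal min_energy"
proof (rule antisym)
  show "(INF \<rho>\<in>prob_densities. free_energy m V \<rho>) \<le> ereal min_energy"
  proof (rule ereal_le_epsilon2)
    fix \<eta> :: real assume "0 < \<eta>"
    then obtain \<rho> where "\<rho> \<in> prob_densities" "free_energy m V \<rho> \<le> ereal min_energy + ereal \<eta>"
      using free_energy_le by blast
    then show "(INF \<rho>\<in>prob_densities. free_energy m V \<rho>) \<le> ereal min_energy + ereal \<eta>"
      by (rule INF_lower2[where f = "free_energy m V"])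
  qed
qed (intro INF_greatest free_energy_ge)

lemma free_energy_ext_ge:
  assumes "\<mu> \<in> borel_probs"
  shows "ereal min_energy \<le> free_energy_ext m V \<mu>"
proof -
  obtain \<nu> where D: "lebesgue_decomposition \<mu> (ac_density \<mu>) \<nu>"
    using lebesgue_decomposition_ac_density[OF assms] .
  have "ereal min_energy \<le> energy m 1 (power_integral m (ac_density \<mu>))
      (potential V (ac_density \<mu>) + (\<integral>\<^sup>+x. ennreal (V x) \<partial>\<nu>))"
    using D free_energy_ext_eq(2)[OF assms D]
    by (intro energy_ge[where n = "emeasure \<nu> UNIV"]) (auto simp: lebesgue_decomposition_def)
  then show ?thesis by (simp only: free_energy_ext_eq(1)[OF assms D])
qed

section \<open>Existence and form of the minimisers\<close>

lemma density_r: "density lborel (\<lambda>x. ennreal (r x)) = density lborel (profile m V h)"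
  using AE_ne by (intro density_cong) (auto simp: profile_eq_rprofile elim!: eventually_mono)

lemma minimiser_exists: "\<exists>\<mu>\<in>borel_probs. free_energy_ext m V \<mu> = ereal min_energy"
proof -
  \<comment> \<open>The missing mass sits at the origin, where it costs nothing since
    \<open>V 0 = 0\<close>.\<close>
  let ?\<nu> = "scale_measure (1 - a) (return borel (0 :: real ^ 'n))"
  let ?f = "density lborel (\<lambda>x. ennreal (r x))"
  obtain \<mu> where s: "sets \<mu> = sets borel"
    and eq: "\<And>A. A \<in> sets borel \<Longrightarrow> emeasure \<mu> A = emeasure ?f A + emeasure ?\<nu> A"
    using emeasure_add_exists[of ?f ?\<nu>] by auto
  have D: "lebesgue_decomposition \<mu> r ?\<nu>"
    unfolding lebesgue_decomposition_def
  proof (intro conjI allI bexI[of _ "{0}"])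
    show "emeasure ?\<nu> (- {0}) = 0" by (simp add: emeasure_scale_measure)
  qed (auto simp: eq)
  have "emeasure ?f UNIV = a" by (subst emeasure_density) (auto simp: mass_r)
  then have "emeasure \<mu> UNIV = 1" using a_add by (simp add: eq emeasure_scale_measure)
  then have \<mu>: "\<mu> \<in> borel_probs"
    using s sets_eq_imp_space_eq[OF s] by (auto simp: borel_probs_def intro!: prob_spaceI)
  have "(\<integral>\<^sup>+x. ennreal (V x) \<partial>?\<nu>) = 0"
    by (subst nn_integral_scale_measure) (auto simp: nn_integral_return V_zero)
  then have "free_energy_ext m V \<mu> = ereal min_energy"
    using energy_r[of 0] by (simp add: free_energy_ext_eq(1)[OF \<mu> D] zero_ennreal.rep_eq)
  with \<mu> show ?thesis by blast
qed

text \<open>At the minimum each nonnegative term of the energy identity vanishes. Zero deficit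
  forces the density to be \<open>r\<close>, and zero potential energy of the singular part puts it
  on the zeros of \<open>V\<close>. If \<open>a = 1\<close>, no singular mass is left.\<close>

lemma minimiser_form:
  assumes \<mu>: "\<mu> \<in> borel_probs" and min: "free_energy_ext m V \<mu> = ereal min_energy"
    and A: "A \<in> sets borel"
  shows "emeasure \<mu> A = (1 - a) * emeasure (return borel 0) A
    + emeasure (density lborel (profile m V h)) A"
proof -
  obtain \<nu> where D: "lebesgue_decomposition \<mu> (ac_density \<mu>) \<nu>"
    using lebesgue_decomposition_ac_density[OF \<mu>] .
  let ?f = "ac_density \<mu>" and ?k = "\<integral>\<^sup>+x. ennreal (V x) \<partial>\<nu>" and ?n = "emeasure \<nu> UNIV"
  have fm [measurable]: "?f \<in> borel_measurable borel" and f0: "\<And>x. 0 \<le> ?f x"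
    and s\<nu>: "sets \<nu> = sets borel"
    and eq: "emeasure \<mu> A = emeasure (density lborel (\<lambda>x. ennreal (?f x))) A + emeasure \<nu> A"
    using D A by (auto simp: lebesgue_decomposition_def)
  have [measurable_cong]: "sets \<nu> = sets borel" by fact
  have sp: "space \<nu> = UNIV" using sets_eq_imp_space_eq[OF s\<nu>] by simp
  have mass: "(\<integral>\<^sup>+x. ennreal (?f x) \<partial>lborel) + ?n = 1" by (rule free_energy_ext_eq(2)[OF \<mu> D])
  have E: "energy m 1 (power_integral m ?f) (potential V ?f + ?k) = ereal min_energy"
    using min free_energy_ext_eq(1)[OF \<mu> D] by simp
  then have "potential V ?f + ?k \<noteq> \<infinity>" by (auto simp: energy_def)
  from energy_eq[OF fm f0 mass this] E
  have "ereal min_energy = ereal min_energy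
    + enn2ereal (?k + (\<integral>\<^sup>+x. ennreal (deficit h ?f x) \<partial>lborel) + ennreal h * ?n)" by simp
  \<comment> \<open>Cancellation in \<open>ereal\<close> is legitimate because
    \<open>min_energy\<close> is real.\<close>
  then have "enn2ereal (?k + (\<integral>\<^sup>+x. ennreal (deficit h ?f x) \<partial>lborel) + ennreal h * ?n) = 0"
    by (cases "enn2ereal (?k + (\<integral>\<^sup>+x. ennreal (deficit h ?f x) \<partial>lborel) + ennreal h * ?n)") auto
  then have "?k + (\<integral>\<^sup>+x. ennreal (deficit h ?f x) \<partial>lborel) + ennreal h * ?n = 0"
    by (metis enn2ereal_inject zero_ennreal.rep_eq)
  then have k0: "?k = 0" and D0: "(\<integral>\<^sup>+x. ennreal (deficit h ?f x) \<partial>lborel) = 0" by auto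
  have "AE x in lborel. ennreal (deficit h ?f x) = 0"
    using D0 by (subst (asm) nn_integral_0_iff_AE) auto
  then have AE_r: "AE x in lborel. ?f x = r x"
    using AE_pos
  proof eventually_elim
    fix x assume "ennreal (deficit h ?f x) = 0" "0 < V x + h"
    then have "deficit h ?f x = 0" using deficit_nonneg[of x h ?f] f0[of x] by auto
    with \<open>0 < V x + h\<close> f0[of x] show "?f x = r x" by (simp add: deficit_eq_0_iff)
  qed
  have df: "density lborel (\<lambda>x. ennreal (?f x)) = density lborel (profile m V h)"
    unfolding density_r[symmetric] using AE_r
    by (intro density_cong) (auto elim!: eventually_mono)
  have "(\<integral>\<^sup>+x. ennreal (?f x) \<partial>lborel) = a"
    unfolding mass_r[symmetric] using AE_r
    by (intro nn_integral_cong_AE) (auto elim!: eventually_mono)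
  \<comment> \<open>Mass balance determines the weight of the singular part.\<close>
  then have "a + ?n = a + (1 - a)" using mass a_add by simp
  moreover have "a \<noteq> \<infinity>" using mass_le by (auto simp: top_unique)
  ultimately have n: "?n = 1 - a" by (simp add: ennreal_add_left_cancel)
  have "emeasure \<nu> A = (1 - a) * emeasure (return borel 0) A"
  proof (cases "a < 1")
    case True
    have "AE x in \<nu>. ennreal (V x) = 0"
      using k0 by (subst (asm) nn_integral_0_iff_AE) auto
    then have z: "AE x in \<nu>. x = 0"
    proof eventually_elim
      fix x assume "ennreal (V x) = 0"
      then have "V x = 0" using V_nonneg[of x] by (simp add: ennreal_eq_0_iff)
      then show "x = 0" using V_pos[OF True] by blast
    qed
    show ?thesis
    proof (cases "0 \<in> A")
      case True
      have "emeasure \<nu> A = emeasure \<nu> UNIV"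
        by (rule emeasure_eq_AE, use z in eventually_elim) (use True A s\<nu> in auto)
      with True A n show ?thesis by simp
    next
      case False
      have "emeasure \<nu> A = emeasure \<nu> {}"
        by (rule emeasure_eq_AE, use z in eventually_elim) (use False A s\<nu> in auto)
      with False A show ?thesis by simp
    qed
  next
    case False
    then have "a = 1" using mass_le by simp
    then have "emeasure \<nu> A \<le> 0"
      using emeasure_mono[of A UNIV \<nu>] s\<nu> n by simp
    with \<open>a = 1\<close> show ?thesis by simp
  qed
  then show ?thesis using eq df by (simp add: add.commute)
qed

lemma INF_free_energy_ext: "(INF \<mu>\<in>borel_probs. free_energy_ext m V \<mu>) = ereal min_energy"
  using minimiser_exists
  by (intro antisym INF_greatest free_energy_ext_ge) (metis INF_lower)

lemma attains_infima_iff: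
  "attains_infima m V \<mu> \<longleftrightarrow> \<mu> \<in> borel_probs \<and> free_energy_ext m V \<mu> = ereal min_energy"
  by (simp add: attains_infima_def INF_free_energy INF_free_energy_ext)

end

section \<open>Consequences of the lower bound\<close>

text \<open>A zero away from the origin would, by monotonicity, make \<open>V\<close> vanish on a
  whole ball, where the profile is infinite.\<close>

lemma radial_zero_unique:
  assumes cont: "continuous_potential m V"
    and mono: "\<And>x y. norm x \<le> norm y \<Longrightarrow> V x \<le> V y"
    and mass: "profile_mass m V 0 \<noteq> \<infinity>" and "V x = 0"
  shows "x = 0"
proof (rule ccontr)
  interpret continuous_potential m V by fact
  assume "x \<noteq> 0"
  let ?B = "cball (0 :: real ^ 'a) (norm x)"
  have "AE y in lborel. y \<notin> ?B"
    using AE_profile_finite[OF mass]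
  proof eventually_elim
    fix y assume "V y + 0 \<noteq> 0"
    then show "y \<notin> ?B" using mono[of y x] V_nonneg[of y] \<open>V x = 0\<close> by auto
  qed
  then have "emeasure lborel ?B = 0"
    by (subst (asm) AE_iff_measurable[where N = ?B]) auto
  moreover have "emeasure lborel ?B > 0"
    using \<open>x \<noteq> 0\<close> by (subst emeasure_cball) auto
  ultimately show False by simp
qed

text \<open>Shrinking \<open>\<epsilon>\<close> only increases the weighted energy, so it may be taken below 1.\<close>

lemma bounded_below_imp_power_bound:
  fixes V :: "real ^ 'n \<Rightarrow> real"
  assumes m: "0 < m" "m < 1" and "0 < \<epsilon>"
    and bdd: "(INF \<rho> \<in> prob_densities. weighted_free_energy (1 - \<epsilon>) m V \<rho>) > - \<infinity>"
  obtains \<delta> M where "0 < \<delta>" "\<delta> < 1" "0 \<le> M"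
    "\<And>\<rho>. \<rho> \<in> prob_densities \<Longrightarrow> potential V \<rho> \<noteq> \<infinity> \<Longrightarrow>
      \<exists>i j. power_integral m \<rho> = ennreal i \<and> potential V \<rho> = ennreal j \<and> 0 \<le> i \<and> 0 \<le> j \<and>
        i \<le> (1 - m) * ((1 - \<delta>) * j + M)"
proof -
  obtain z where z: "ereal z < (INF \<rho> \<in> prob_densities. weighted_free_energy (1 - \<epsilon>) m V \<rho>)"
    using ereal_dense2[OF bdd] by blast
  define \<delta> where "\<delta> = min \<epsilon> (1 / 2)"
  show thesis
  proof (rule that[of \<delta> "max 0 (- z)"])
    fix \<rho> :: "real ^ 'n \<Rightarrow> real"
    assume \<rho>: "\<rho> \<in> prob_densities" and "potential V \<rho> \<noteq> \<infinity>"
    then obtain j where j: "potential V \<rho> = ennreal j" "0 \<le> j"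
      by (metis ennreal_cases infinity_ennreal_def)
    have "ereal z < weighted_free_energy (1 - \<epsilon>) m V \<rho>"
      using z \<rho> by (rule less_INF_D)
    then have lt: "ereal z < ereal (1 / (m - 1)) * enn2ereal (power_integral m \<rho>) + ereal ((1 - \<epsilon>) * j)"
      using j by (simp add: weighted_free_energy_def energy_def enn2ereal_ennreal)
    \<comment> \<open>With finite potential energy, an infinite power integral would give energy
      \<open>- \<infinity>\<close>, below \<open>z\<close>.\<close>
    have "power_integral m \<rho> \<noteq> \<infinity>"
    proof
      assume "power_integral m \<rho> = \<infinity>"
      then show False using lt m by (simp add: top_ennreal.rep_eq)
    qed
    then obtain i where i: "power_integral m \<rho> = ennreal i" "0 \<le> i"
      by (metis ennreal_cases infinity_ennreal_def)
    have "z < 1 / (m - 1) * i + (1 - \<epsilon>) * j"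
      using lt i by (simp add: enn2ereal_ennreal)
    moreover have "1 / (m - 1) * i = - (i / (1 - m))" using m by (simp add: field_simps)
    moreover have "(1 - \<epsilon>) * j \<le> (1 - \<delta>) * j" using j by (intro mult_right_mono) (auto simp: \<delta>_def)
    ultimately have "i / (1 - m) \<le> (1 - \<delta>) * j + max 0 (- z)" by linarith
    then have "i \<le> (1 - m) * ((1 - \<delta>) * j + max 0 (- z))"
      using m by (simp add: divide_le_eq mult.commute)
    with i j show "\<exists>i j. power_integral m \<rho> = ennreal i \<and> potential V \<rho> = ennreal j \<and> 0 \<le> i \<and> 0 \<le> j \<and>
        i \<le> (1 - m) * ((1 - \<delta>) * j + max 0 (- z))" by blast
  qed (use \<open>0 < \<epsilon>\<close> in \<open>auto simp: \<delta>_def\<close>)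
qed

text \<open>A large additive constant \<open>K\<close> always works. If the infimum exceeds -1, then
  \<open>1 + free_energy m V \<rho>\<close> is bounded away from 0, and the surplus
  \<open>K - 1\<close> can be absorbed into the factor \<open>C\<close>.\<close>

lemma coercivity:
  fixes V :: "real ^ 'n \<Rightarrow> real"
  assumes m: "0 < m" "m < 1" and \<delta>: "0 < \<delta>" "\<delta> < 1" and M: "0 \<le> M"
    and bound: "\<And>\<rho>. \<rho> \<in> prob_densities \<Longrightarrow> potential V \<rho> \<noteq> \<infinity> \<Longrightarrow>
      \<exists>i j. power_integral m \<rho> = ennreal i \<and> potential V \<rho> = ennreal j \<and> 0 \<le> i \<and> 0 \<le> j \<and>
        i \<le> (1 - m) * ((1 - \<delta>) * j + M)"
  shows "\<exists>C > 0. \<exists>K > 0.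
    (\<forall>\<rho> \<in> prob_densities.
       enn2ereal (power_integral m \<rho> + potential V \<rho>) \<le> ereal C * (ereal K + free_energy m V \<rho>)) \<and>
    ((INF \<rho> \<in> prob_densities. free_energy m V \<rho>) > - 1 \<longrightarrow> K = 1)"
proof -
  \<comment> \<open>The estimate below yields \<open>2 / \<delta> * (e + 2 * M)\<close>; the extra 1
    makes \<open>K\<close> positive when \<open>M = 0\<close>.\<close>
  define K where "K = 2 * M + 1"
  define C where "C = 2 / \<delta>"
  have C: "C > 0" "K > 0" using \<delta> M by (auto simp: C_def K_def)
  have real_bound: "\<exists>s e. enn2ereal (power_integral m \<rho> + potential V \<rho>) = ereal s \<and>
      free_energy m V \<rho> = ereal e \<and> s \<le> C * (K + e)"
    if \<rho>: "\<rho> \<in> prob_densities" and J: "potential V \<rho> \<noteq> \<infinity>" for \<rho>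
  proof -
    obtain i j where i: "power_integral m \<rho> = ennreal i" "0 \<le> i"
      and j: "potential V \<rho> = ennreal j" "0 \<le> j" and le: "i \<le> (1 - m) * ((1 - \<delta>) * j + M)"
      using bound[OF \<rho> J] by blast
    define e where "e = j - i / (1 - m)"
    have "1 / (m - 1) * i = - (i / (1 - m))" using m by (simp add: field_simps)
    then have e: "free_energy m V \<rho> = ereal e"
      using i j by (simp add: free_energy_def weighted_free_energy_def energy_def enn2ereal_ennreal e_def)
    have "i / (1 - m) \<le> (1 - \<delta>) * j + M" using le m by (simp add: divide_le_eq mult.commute)
    then have "\<delta> * j \<le> e + M" by (simp add: e_def algebra_simps)
    then have jle: "j \<le> (e + M) / \<delta>" using \<delta> by (simp add: field_simps)
    have nn: "0 \<le> (1 - \<delta>) * j + M" using \<delta> j M by simp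
    have "i \<le> 1 * ((1 - \<delta>) * j + M)"
      using le mult_right_mono[OF _ nn, of "1 - m" 1] m by linarith
    moreover have "(1 - \<delta>) * j \<le> 1 * j" using \<delta> j by (intro mult_right_mono) auto
    ultimately have "i + j \<le> 2 * j + M" by simp
    also have "\<dots> \<le> 2 * ((e + M) / \<delta>) + 2 * (M / \<delta>)"
    proof -
      have "M \<le> M / \<delta>" using M \<delta> by (simp add: le_divide_eq mult_left_le)
      moreover have "0 \<le> M / \<delta>" using M \<delta> by simp
      ultimately show ?thesis using jle by linarith
    qed
    also have "\<dots> \<le> C * (K + e)" using \<delta> by (simp add: C_def K_def field_simps)
    finally have "i + j \<le> C * (K + e)" .
    moreover have "enn2ereal (power_integral m \<rho> + potential V \<rho>) = ereal (i + j)"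
      using i j by (simp add: enn2ereal_ennreal flip: ennreal_plus)
    ultimately show ?thesis using e by blast
  qed
  show ?thesis
  proof (cases "(INF \<rho> \<in> prob_densities. free_energy m V \<rho>) > - 1")
    case False
    have "enn2ereal (power_integral m \<rho> + potential V \<rho>) \<le> ereal C * (ereal K + free_energy m V \<rho>)"
      if \<rho>: "\<rho> \<in> prob_densities" for \<rho>
    proof (cases "potential V \<rho> = \<infinity>")
      case True
      then show ?thesis using C by (simp add: free_energy_def weighted_free_energy_def energy_def)
    next
      case False
      then show ?thesis using real_bound[OF \<rho>] by auto
    qed
    with False C show ?thesis by blast
  next
    case True
    then have "ereal (- 1) < (INF \<rho> \<in> prob_densities. free_energy m V \<rho>)"
      by (simp add: one_ereal_def)
    then obtain z where z: "ereal (- 1) < ereal z" "ereal z < (INF \<rho> \<in> prob_densities. free_energy m V \<rho>)"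
      using ereal_dense2 by blast
    \<comment> \<open>A positive lower bound for \<open>1 + e\<close>, so that
      \<open>2 * M \<le> 2 * M / s * (1 + e)\<close>; this explains the factor in
      \<open>C'\<close>.\<close>
    define s where "s = z + 1"
    have s: "s > 0" using z by (simp add: s_def)
    define C' where "C' = C * (1 + 2 * M / s)"
    have C': "C' > 0" using C s M by (auto simp: C'_def intro!: mult_pos_pos add_pos_nonneg)
    have "enn2ereal (power_integral m \<rho> + potential V \<rho>) \<le> ereal C' * (ereal 1 + free_energy m V \<rho>)"
      if \<rho>: "\<rho> \<in> prob_densities" for \<rho>
    proof (cases "potential V \<rho> = \<infinity>")
      case True
      then show ?thesis using C' by (simp add: free_energy_def weighted_free_energy_def energy_def)
    next
      case False
      then obtain t e where t: "enn2ereal (power_integral m \<rho> + potential V \<rho>) = ereal t"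
        and e: "free_energy m V \<rho> = ereal e" and le: "t \<le> C * (K + e)"
        using real_bound[OF \<rho>] by auto
      have "ereal z < free_energy m V \<rho>" using z(2) \<rho> by (rule less_INF_D)
      then have "s \<le> 1 + e" using e by (simp add: s_def)
      then have "2 * M * s \<le> 2 * M * (1 + e)" using M by (intro mult_left_mono) auto
      then have "2 * M \<le> 2 * M / s * (1 + e)" using s by (simp add: field_simps)
      then have "K + e \<le> (1 + 2 * M / s) * (1 + e)" by (simp add: K_def algebra_simps)
      then have "C * (K + e) \<le> C' * (1 + e)"
        using C by (simp add: C'_def mult.assoc)
      with le show ?thesis using t e by simp
    qed
    with C' show ?thesis by (intro exI[of _ C'] conjI exI[of _ "1 :: real"]) auto
  qed
qed

text \<open>The form is asserted for every minimiser, which includes uniqueness. The case with a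
  Dirac mass is stated setwise, as a sum of measures.\<close>

theorem proposition7p5:
  fixes m :: real and V :: "real ^ 'n \<Rightarrow> real"
  assumes m: "0 < m" "m < 1"
    and V_reg: "V \<in> W2inf_loc"
    and V_nonneg: "\<forall>x. 0 \<le> V x"
    and V_zero: "V 0 = 0"
    and bdd: "\<exists>\<epsilon>>0. (INF \<rho> \<in> prob_densities. weighted_free_energy (1 - \<epsilon>) m V \<rho>) > - \<infinity>"
  shows "(\<exists>C > 0. \<exists>K > 0.
            (\<forall>\<rho> \<in> prob_densities.
               enn2ereal (power_integral m \<rho> + potential V \<rho>) \<le> ereal C * (ereal K + free_energy m V \<rho>)) \<and>
            ((INF \<rho> \<in> prob_densities. free_energy m V \<rho>) > - 1 \<longrightarrow> K = 1)) \<and>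
         ((\<forall>x y. norm x = norm y \<longrightarrow> V x = V y) \<and> (\<forall>x y. norm x \<le> norm y \<longrightarrow> V x \<le> V y) \<longrightarrow>
            (\<exists>\<mu>. attains_infima m V \<mu>) \<and>
            (\<forall>\<mu>. attains_infima m V \<mu> \<longrightarrow>
               ((\<exists>h\<ge>0. profile_mass m V h = 1) \<or> profile_mass m V 0 < 1) \<and>
               (\<forall>h\<ge>0. profile_mass m V h = 1 \<longrightarrow> \<mu> = density lborel (profile m V h)) \<and>
               (profile_mass m V 0 < 1 \<longrightarrow>
                  (\<forall>A \<in> sets borel. emeasure \<mu> A =
                     (1 - profile_mass m V 0) * emeasure (return borel 0) A
                     + emeasure (density lborel (profile m V 0)) A))))"
proof -
  obtain \<epsilon> where "\<epsilon> > 0" "(INF \<rho> \<in> prob_densities. weighted_free_energy (1 - \<epsilon>) m V \<rho>) > - \<infinity>"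
    using bdd by blast
  then obtain \<delta> M where \<delta>: "0 < \<delta>" "\<delta> < 1" "0 \<le> M"
    and bound: "\<And>\<rho>. \<rho> \<in> prob_densities \<Longrightarrow> potential V \<rho> \<noteq> \<infinity> \<Longrightarrow>
      \<exists>i j. power_integral m \<rho> = ennreal i \<and> potential V \<rho> = ennreal j \<and> 0 \<le> i \<and> 0 \<le> j \<and>
        i \<le> (1 - m) * ((1 - \<delta>) * j + M)"
    using bounded_below_imp_power_bound[OF m] by metis
  have cp: "continuous_potential m V"
    using m V_reg V_nonneg V_zero by unfold_locales (auto simp: W2inf_loc_def)
  interpret confining_potential m V M
  proof (intro confining_potential.intro cp confining_potential_axioms.intro)
    fix \<rho> assume "\<rho> \<in> prob_densities" "potential V \<rho> \<noteq> \<infinity>"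
    then obtain i j where i: "power_integral m \<rho> = ennreal i" "0 \<le> i"
      and j: "potential V \<rho> = ennreal j" "0 \<le> j" and le: "i \<le> (1 - m) * ((1 - \<delta>) * j + M)"
      using bound by blast
    \<comment> \<open>Giving up the gain \<open>\<delta>\<close> leaves the plain lower bound on the
      free energy; the gain itself is kept for \<open>coercivity\<close>.\<close>
    have "(1 - \<delta>) * j \<le> j" using \<delta> j by (simp add: mult_left_le_one_le)
    then have "(1 - m) * ((1 - \<delta>) * j + M) \<le> (1 - m) * (j + M)"
      using m by (intro mult_left_mono) auto
    with le have "i \<le> (1 - m) * (j + M)" by linarith
    then show "power_integral m \<rho> \<le> ennreal (1 - m) * (potential V \<rho> + ennreal M)"
      using i j m \<delta> by (simp add: ennreal_leI flip: ennreal_plus ennreal_mult)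
  qed (use \<delta> in auto)
  have minimisers: "(\<exists>\<mu>. attains_infima m V \<mu>) \<and>
      (\<forall>\<mu>. attains_infima m V \<mu> \<longrightarrow>
         ((\<exists>h\<ge>0. profile_mass m V h = 1) \<or> profile_mass m V 0 < 1) \<and>
         (\<forall>h\<ge>0. profile_mass m V h = 1 \<longrightarrow> \<mu> = density lborel (profile m V h)) \<and>
         (profile_mass m V 0 < 1 \<longrightarrow>
            (\<forall>A \<in> sets borel. emeasure \<mu> A =
               (1 - profile_mass m V 0) * emeasure (return borel 0) A
               + emeasure (density lborel (profile m V 0)) A)))"
    if mono: "\<forall>x y. norm x \<le> norm y \<longrightarrow> V x \<le> V y"
  proof -
    have eq0: "equilibrium m V 0" if "profile_mass m V 0 < 1"
    proof (intro equilibrium.intro cp equilibrium_axioms.intro)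
      show "power_integral m (rprofile m V 0) \<noteq> \<infinity>"
        using power_integral_rprofile_le[of 0] less_imp_le[OF that] by (auto simp: top_unique)
      have "profile_mass m V 0 \<noteq> \<infinity>" using that by auto
      then show "V x \<noteq> 0" if "x \<noteq> 0" for x
        using radial_zero_unique[OF cp, of x] mono that by auto
    qed (use that in auto)
    have eq1: "equilibrium m V h" if "profile_mass m V h = 1" "0 \<le> h" for h
    proof (intro equilibrium.intro cp equilibrium_axioms.intro)
      show "power_integral m (rprofile m V h) \<noteq> \<infinity>"
        using power_integral_rprofile_le[of h] that by (auto simp: top_unique)
    qed (use that in auto)
    \<comment> \<open>Trichotomy for the mass at level 0; when it exceeds 1, a positive level has
      mass exactly 1.\<close>
    have ex: "(\<exists>h\<ge>0. profile_mass m V h = 1) \<or> profile_mass m V 0 < 1"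
      using profile_mass_eq_1 by (metis less_imp_le linorder_neqE order_refl)
    then obtain h where "equilibrium m V h" using eq0 eq1 by blast
    then interpret E: equilibrium m V h .
    have "\<exists>\<mu>. attains_infima m V \<mu>"
      using E.minimiser_exists by (auto simp: E.attains_infima_iff)
    moreover have "\<mu> = density lborel (profile m V h)"
      if \<mu>: "attains_infima m V \<mu>" and h: "h \<ge> 0" "profile_mass m V h = 1" for \<mu> h
    proof -
      \<comment> \<open>Here \<open>h\<close> is an arbitrary level of mass 1 rather than the one
        chosen for \<open>E\<close>; \<open>attains_infima\<close> does not mention the level, so
        the minimiser carries over.\<close>
      interpret H: equilibrium m V h using eq1 h by blast
      have \<mu>': "\<mu> \<in> borel_probs" "free_energy_ext m V \<mu> = ereal H.min_energy"
        using \<mu> by (simp_all add: H.attains_infima_iff)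
      show ?thesis
      proof (rule measure_eqI)
        show "sets \<mu> = sets (density lborel (profile m V h))"
          using \<mu>' by (simp add: borel_probs_def)
        fix A assume "A \<in> sets \<mu>"
        then have "A \<in> sets borel" using \<mu>' by (simp add: borel_probs_def)
        then show "emeasure \<mu> A = emeasure (density lborel (profile m V h)) A"
          using H.minimiser_form[OF \<mu>'] h by simp
      qed
    qed
    moreover have "emeasure \<mu> A = (1 - profile_mass m V 0) * emeasure (return borel 0) A
        + emeasure (density lborel (profile m V 0)) A"
      if \<mu>: "attains_infima m V \<mu>" and h: "profile_mass m V 0 < 1" and A: "A \<in> sets borel" for \<mu> A
    proof -
      interpret H: equilibrium m V 0 using eq0 h by blast
      show ?thesis using \<mu> A by (intro H.minimiser_form) (simp_all add: H.attains_infima_iff)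
    qed
    ultimately show ?thesis using ex by blast
  qed
  show ?thesis
    using coercivity[OF m \<delta> bound] minimisers by blast
qed

end
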